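(* Let $(X,L)$ be a polarized toric variety (over $\mathbb{C}$) of dimension $n$ with $\Gamma(X,L\otimes\omega_X)\neq 0$, where $\omega_X$ is the dualizing sheaf of $X$. Then $$ \Delta(X,L)\ \ge\ n-1. $$ Moreover, when $n\ge 3$, equality holds if and only if $(X,L)$ is the Gorenstein toric Fano variety which is a mirror to $(\mathbb{P}^n,\mathcal{O}(n+1))$, i.e. if and only if the lattice polytope corresponding to $(X,L)$ is isomorphic to $$ \Delta_*^n:=\mathrm{conv}\{e_1,\dots,e_n,\,-e_1-\cdots-e_n\}, $$ where $e_1,\dots,e_n$ is a basis of the character lattice $M$.
   Context: A toric variety $X$ of dimension $n$ is a normal complex algebraic variety with an algebraic action of the algebraic torus $T=\mathrm{Spec}\,\mathbb{C}[M]$ ($M$ a free abelian group of rank $n$, the character lattice) that has an open orbit isomorphic to $T$, on which the action is the multiplication of $T$. A polarized toric variety $(X,L)$ is a pair of a projective toric variety $X$ and an ample line bundle $L$ on $X$. Its $\Delta$-genus is $\Delta(X,L):=n+L^n-\dim\Gamma(X,L)$, where $n=\dim X$ and $L^n$ is the top self-intersection number (degree) of $L$. Correspondence with polytopes: $n$-dimensional polarized toric varieties $(X,L)$ correspond to lattice polytopes $P\subset M_{\mathbb{R}}=M\otimes\mathbb{R}$ of dimension $n$ (convex hulls of finitely many points of $M$). Under this correspondence $\Gamma(X,L)$ has a basis indexed by $P\cap M$, $\Gamma(X,L\otimes\omega_X)$ has a basis indexed by $\mathrm{int}(P)\cap M$, and $L^n=n!\,\mathrm{vol}(P)$. Hence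 $\Delta(X,L)=\Delta(P):=n+n!\,\mathrm{vol}(P)-\sharp(P\cap M)$, and the hypothesis $\Gamma(X,L\otimes\omega_X)\ne0$ says $\mathrm{int}(P)\cap M\neq\emptyset$. Two lattice polytopes are isomorphic if some affine automorphism of $M_{\mathbb{R}}$ preserving $M$ maps one onto the other. *)

theory Defs
  imports "HOL-Analysis.Analysis" "HOL-Library.Poly_Mapping"
begin

text \<open>
  The character lattice is \<open>M = \<int>\<^sup>n\<close>, the type \<open>int ^ 'n\<close> with \<open>n = CARD('n)\<close>, embedded into
  \<open>M\<^sub>\<real> = real ^ 'n\<close>. A choice of basis of \<open>M\<close> reduces the general case to this one.
\<close>

definition lattice_vec :: "int ^ 'n \<Rightarrow> real ^ 'n"
  where "lattice_vec m = (\<chi> i. of_int (m $ i))"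

definition lattice_polytope :: "(real ^ 'n) set \<Rightarrow> bool"
  where "lattice_polytope P \<longleftrightarrow> (\<exists>V. finite V \<and> V \<subseteq> range lattice_vec \<and> P = convex hull V)"

definition lattice_isomorphic :: "(real ^ 'n) set \<Rightarrow> (real ^ 'n) set \<Rightarrow> bool"
  where "lattice_isomorphic P Q \<longleftrightarrow>
    (\<exists>A b. bij (\<lambda>x. A *v x + b) \<and>
       (\<lambda>x. A *v x + b) ` range lattice_vec = range lattice_vec \<and>
       (\<lambda>x. A *v x + b) ` P = Q)"

definition mirror_polytope :: "(real ^ 'n) set"
  where "mirror_polytope = convex hull (insert (- (\<Sum>i\<in>UNIV. axis i 1)) (range (\<lambda>i. axis i 1)))"


text \<open>
  The coordinate ring \<open>\<complex>[M]\<close> of the torus; \<open>character m\<close> is \<open>\<chi>\<^sup>m\<close>. All section spaces below are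
  subspaces of it: sections of a line bundle on a toric variety restrict injectively to the torus,
  where a line bundle is trivial.
\<close>

type_synonym 'n laurent = "(int ^ 'n) \<Rightarrow>\<^sub>0 complex"

definition character :: "int ^ 'n \<Rightarrow> 'n laurent"
  where "character m = Poly_Mapping.single m 1"

definition laurent_scale :: "complex \<Rightarrow> 'n::finite laurent \<Rightarrow> 'n laurent"
  where "laurent_scale c f = Poly_Mapping.single 0 c * f"

lemma lookup_single_mult:
  fixes f :: "'a::ab_group_add \<Rightarrow>\<^sub>0 'b::semiring_0"
  shows "Poly_Mapping.lookup (Poly_Mapping.single m c * f) k = c * Poly_Mapping.lookup f (k - m)"
proof -
  have eq: "k = m + q \<longleftrightarrow> q = k - m" for q
    by (auto simp: algebra_simps)
  have "Poly_Mapping.lookup (Poly_Mapping.single m c * f) k =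
      Sum_any (\<lambda>l. (c * Sum_any (\<lambda>q. Poly_Mapping.lookup f q when k = l + q)) when m = l)"
    by (simp only: lookup_mult lookup_single when_mult)
  also have "\<dots> = c * Poly_Mapping.lookup f (k - m)"
    by (simp add: eq)
  finally show ?thesis .
qed

lemma lookup_laurent_scale:
  "Poly_Mapping.lookup (laurent_scale c f) k = c * Poly_Mapping.lookup f k"
  by (simp add: laurent_scale_def lookup_single_mult)

interpretation laurent: vector_space "laurent_scale :: complex \<Rightarrow> 'n::finite laurent \<Rightarrow> 'n laurent"
  by unfold_locales
    (auto intro!: poly_mapping_eqI simp: lookup_laurent_scale lookup_add algebra_simps)


text \<open>
  The polarized toric variety \<open>(X, L)\<close> of a full-dimensional lattice polytope \<open>P\<close>: for each
  vertex \<open>v\<close> of \<open>P\<close>, let \<open>C\<^sub>v\<close> be the cone generated by \<open>P - v\<close>. \<open>X\<close> is glued from the affine toric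
  varieties \<open>U\<^sub>v = Spec \<complex>[C\<^sub>v \<inter> M]\<close>, and \<open>L\<close> is the invertible subsheaf of the constant sheaf
  \<open>\<complex>(M)\<close> that is generated by \<open>\<chi>\<^sup>v\<close> on \<open>U\<^sub>v\<close>. Every polarized toric variety arises from a
  unique \<open>P\<close> up to isomorphism. Trivializing \<open>\<omega>\<^sub>X\<close> on the torus by the invariant
  \<open>n\<close>-form, its module of sections over \<open>U\<^sub>v\<close> is spanned by the \<open>\<chi>\<^sup>m\<close> with \<open>m\<close> in the interior
  of \<open>C\<^sub>v\<close>.
\<close>

definition lattice_vertices :: "(real ^ 'n) set \<Rightarrow> (int ^ 'n) set"
  where "lattice_vertices P = {v. lattice_vec v extreme_point_of P}"

definition vertex_cone :: "(real ^ 'n) set \<Rightarrow> int ^ 'n \<Rightarrow> (real ^ 'n) set"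
  where "vertex_cone P v = convex_cone hull ((\<lambda>x. x - lattice_vec v) ` P)"

definition chart_functions :: "(real ^ 'n) set \<Rightarrow> int ^ 'n \<Rightarrow> 'n laurent set"
  where "chart_functions P v = {f. lattice_vec ` Poly_Mapping.keys f \<subseteq> vertex_cone P v}"

definition chart_dualizing :: "(real ^ 'n) set \<Rightarrow> int ^ 'n \<Rightarrow> 'n laurent set"
  where "chart_dualizing P v = {f. lattice_vec ` Poly_Mapping.keys f \<subseteq> interior (vertex_cone P v)}"

text \<open>\<open>\<Gamma>(X, L\<^sup>k)\<close> and \<open>\<Gamma>(X, L \<otimes> \<omega>\<^sub>X)\<close>\<close>

definition power_sections :: "(real ^ 'n::finite) set \<Rightarrow> nat \<Rightarrow> 'n laurent set"
  where "power_sections P k =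
    (\<Inter>v\<in>lattice_vertices P. (\<lambda>f. character (int k *s v) * f) ` chart_functions P v)"

definition adjoint_sections :: "(real ^ 'n::finite) set \<Rightarrow> 'n laurent set"
  where "adjoint_sections P =
    (\<Inter>v\<in>lattice_vertices P. (\<lambda>f. character v * f) ` chart_dualizing P v)"

text \<open>
  The top self-intersection number \<open>L\<^sup>n\<close> is \<open>n!\<close> times the leading coefficient of the Hilbert polynomial of the ample bundle \<open>L\<close>.
\<close>

definition polarization_degree :: "(real ^ 'n::finite) set \<Rightarrow> real"
  where "polarization_degree P =
    lim (\<lambda>k. fact CARD('n) * real (laurent.dim (power_sections P k)) / real k ^ CARD('n))"

definition delta_genus :: "(real ^ 'n::finite) set \<Rightarrow> real"
  where "delta_genus P = real CARD('n) + polarization_degree P - real (laurent.dim (power_sections P 1))"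


subsection \<open>The dictionary between section spaces and lattice points\<close>

lemma lattice_vec_inject [simp]: "lattice_vec a = lattice_vec b \<longleftrightarrow> a = b"
  by (auto simp: lattice_vec_def vec_eq_iff)

lemma lattice_vec_diff: "lattice_vec (a - b) = lattice_vec a - lattice_vec b"
  by (auto simp: lattice_vec_def vec_eq_iff)

lemma lattice_vec_scale: "lattice_vec (int k *s v) = real k *\<^sub>R lattice_vec v"
  by (auto simp: lattice_vec_def vec_eq_iff)

lemma keys_character_mult:
  "Poly_Mapping.keys (character v * f) = {m. m - v \<in> Poly_Mapping.keys f}" for f :: "'n::finite laurent"
  by (auto simp: character_def in_keys_iff lookup_single_mult)

lemma character_mult_inverse: "character v * (character (- v) * f) = f" for f :: "'n::finite laurent"
  by (rule poly_mapping_eqI) (simp add: character_def lookup_single_mult)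

lemma character_image:
  fixes v :: "int ^ 'n::finite"
  shows "(\<lambda>f. character v * f) ` {f. lattice_vec ` Poly_Mapping.keys f \<subseteq> C} =
    {f. \<forall>m\<in>Poly_Mapping.keys f. lattice_vec m - lattice_vec v \<in> C}" (is "?L = ?R")
proof
  show "?L \<subseteq> ?R" by (auto simp: keys_character_mult image_subset_iff simp flip: lattice_vec_diff)
  show "?R \<subseteq> ?L"
  proof
    fix f assume f: "f \<in> ?R"
    have "lattice_vec ` Poly_Mapping.keys (character (- v) * f) \<subseteq> C"
    proof (clarsimp simp: keys_character_mult)
      fix m assume "m + v \<in> Poly_Mapping.keys f"
      with f have "lattice_vec (m + v - v) \<in> C" by (auto simp only: lattice_vec_diff)
      then show "lattice_vec m \<in> C" by simp
    qed
    then show "f \<in> ?L"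
      by (intro image_eqI[of _ _ "character (- v) * f"]) (simp_all add: character_mult_inverse)
  qed
qed

lemma lattice_vertices_image:
  assumes "lattice_polytope P"
  shows "lattice_vec ` lattice_vertices P = {x. x extreme_point_of P}"
proof -
  have "x \<in> range lattice_vec" if "x extreme_point_of P" for x
    using assms that extreme_point_of_convex_hull unfolding lattice_polytope_def by blast
  then show ?thesis unfolding lattice_vertices_def by auto
qed

lemma finite_lattice_vertices:
  assumes "lattice_polytope P" shows "finite (lattice_vertices P)"
proof -
  obtain V where V: "finite V" "P = convex hull V" using assms unfolding lattice_polytope_def by blast
  have "lattice_vec ` lattice_vertices P \<subseteq> V"
    using lattice_vertices_image[OF assms] extreme_point_of_convex_hull V by auto
  then have "finite (lattice_vec ` lattice_vertices P)" using V finite_subset by blast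
  then show ?thesis by (rule finite_imageD) (auto simp: inj_on_def)
qed

lemma lattice_polytope_compact: "lattice_polytope P \<Longrightarrow> compact P"
  unfolding lattice_polytope_def using finite_imp_compact_convex_hull by auto

lemma lattice_polytope_convex: "lattice_polytope P \<Longrightarrow> convex P"
  unfolding lattice_polytope_def by auto

lemma mem_scaled_polytope:
  assumes P: "lattice_polytope P" "P \<noteq> {}"
  shows "(\<forall>v\<in>lattice_vertices P. x - real k *\<^sub>R lattice_vec v \<in> vertex_cone P v)
      \<longleftrightarrow> x \<in> (\<lambda>y. real k *\<^sub>R y) ` P" (is "?L \<longleftrightarrow> ?R")
proof
  assume ?R
  then obtain y where y: "y \<in> P" "x = real k *\<^sub>R y" by auto
  have "real k *\<^sub>R (y - lattice_vec v) \<in> vertex_cone P v" for v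
    unfolding vertex_cone_def using y
    by (intro convex_cone_hull_mul) (auto intro: hull_inc)
  then show ?L using y by (simp add: algebra_simps)
next
  assume L: ?L
  show ?R
  proof (rule ccontr)
    assume "\<not> ?R"
    have "convex ((\<lambda>y. real k *\<^sub>R y) ` P)" "closed ((\<lambda>y. real k *\<^sub>R y) ` P)"
      using lattice_polytope_convex lattice_polytope_compact P
      by (auto intro: convex_scaling compact_imp_closed compact_scaling)
    from separating_hyperplane_closed_point[OF this \<open>\<not> ?R\<close>]
    obtain a b where ab: "a \<bullet> x < b" "\<And>y. y \<in> P \<Longrightarrow> a \<bullet> (real k *\<^sub>R y) > b" by blast
    have "continuous_on P (\<lambda>y. a \<bullet> y)" by (intro continuous_intros)
    then obtain z where z: "z \<in> P" "\<And>y. y \<in> P \<Longrightarrow> a \<bullet> z \<le> a \<bullet> y"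
      using continuous_attains_inf[OF lattice_polytope_compact] P by blast
    let ?F = "P \<inter> {y. a \<bullet> y = a \<bullet> z}"
    have F: "?F face_of P"
      using face_of_Int_supporting_hyperplane_ge[OF lattice_polytope_convex] P z by blast
    have "compact ?F" using face_of_imp_compact[OF lattice_polytope_convex lattice_polytope_compact F] P by blast
    moreover have "convex ?F" using F face_of_imp_convex by blast
    moreover have "?F \<noteq> {}" using z by auto
    ultimately obtain w where w: "w extreme_point_of ?F"
      using extreme_point_exists_convex by blast
    then have "w extreme_point_of P" using extreme_point_of_face[OF F] by auto
    then obtain v where v: "v \<in> lattice_vertices P" "w = lattice_vec v"
      using lattice_vertices_image[OF P(1)] by blast
    have wF: "a \<bullet> w = a \<bullet> z" "w \<in> P" using w unfolding extreme_point_of_def by auto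
    have "vertex_cone P v \<subseteq> {y. 0 \<le> a \<bullet> y}"
      unfolding vertex_cone_def
    proof (rule hull_minimal)
      show "(\<lambda>x. x - lattice_vec v) ` P \<subseteq> {y. 0 \<le> a \<bullet> y}"
        using z wF v by (auto simp: inner_diff_right)
      show "convex_cone {y. 0 \<le> a \<bullet> y}"
        using convex_cone_halfspace_ge[of a] by simp
    qed
    then have "0 \<le> a \<bullet> (x - real k *\<^sub>R w)" using L v by auto
    moreover have "a \<bullet> (real k *\<^sub>R w) > b" using ab wF by blast
    ultimately show False using ab by (simp add: inner_diff_right)
  qed
qed

lemma power_sections_eq:
  assumes P: "lattice_polytope P" "P \<noteq> {}"
  shows "power_sections P k = {f. lattice_vec ` Poly_Mapping.keys f \<subseteq> (\<lambda>y. real k *\<^sub>R y) ` P}"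
proof -
  have "f \<in> power_sections P k \<longleftrightarrow>
      (\<forall>m\<in>Poly_Mapping.keys f. \<forall>v\<in>lattice_vertices P.
        lattice_vec m - real k *\<^sub>R lattice_vec v \<in> vertex_cone P v)" for f
    unfolding power_sections_def chart_functions_def character_image lattice_vec_scale by blast
  then show ?thesis unfolding mem_scaled_polytope[OF assms] by (intro set_eqI) (simp only: mem_Collect_eq image_subset_iff)
qed

lemma interior_image_diff:
  fixes a :: "'a::euclidean_space"
  shows "interior ((\<lambda>x. x - a) ` S) = (\<lambda>x. x - a) ` interior S"
  using interior_translation[of "- a" S] by simp

lemma adjoint_sections_eq:
  assumes P: "lattice_polytope P" "P \<noteq> {}"
  shows "adjoint_sections P = {f. lattice_vec ` Poly_Mapping.keys f \<subseteq> interior P}"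
proof -
  have eq: "f \<in> adjoint_sections P \<longleftrightarrow>
      (\<forall>m\<in>Poly_Mapping.keys f. \<forall>v\<in>lattice_vertices P.
        lattice_vec m - lattice_vec v \<in> interior (vertex_cone P v))" for f
    unfolding adjoint_sections_def chart_dualizing_def character_image by blast
  have "(\<forall>v\<in>lattice_vertices P. x - lattice_vec v \<in> interior (vertex_cone P v))
      \<longleftrightarrow> x \<in> interior P" (is "?L \<longleftrightarrow> ?R") for x
  proof
    assume ?R
    show ?L
    proof
      fix v
      have "(\<lambda>x. x - lattice_vec v) ` P \<subseteq> vertex_cone P v"
        unfolding vertex_cone_def by (rule hull_subset)
      then have "interior ((\<lambda>x. x - lattice_vec v) ` P) \<subseteq> interior (vertex_cone P v)"
        by (rule interior_mono)
      then show "x - lattice_vec v \<in> interior (vertex_cone P v)"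
        using \<open>?R\<close> by (auto simp: interior_image_diff)
    qed
  next
    assume L: ?L
    let ?U = "\<Inter>v\<in>lattice_vertices P. {y. y - lattice_vec v \<in> interior (vertex_cone P v)}"
    have "open {y. y - lattice_vec v \<in> interior (vertex_cone P v)}" for v
    proof -
      have "continuous_on UNIV (\<lambda>y. y - lattice_vec v)" by (intro continuous_intros)
      from open_vimage[OF open_interior this] show ?thesis unfolding vimage_def .
    qed
    then have "open ?U" using finite_lattice_vertices[OF P(1)] by (intro open_INT) auto
    moreover have "?U \<subseteq> P"
    proof
      fix y assume "y \<in> ?U"
      then have "\<forall>v\<in>lattice_vertices P. y - real 1 *\<^sub>R lattice_vec v \<in> vertex_cone P v"
        using interior_subset by fastforce
      then show "y \<in> P" using mem_scaled_polytope[OF assms, where k = 1] by auto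
    qed
    ultimately show ?R using L interior_maximal by blast
  qed
  then show ?thesis using eq by (intro set_eqI) (simp only: mem_Collect_eq image_subset_iff)
qed

lemma adjoint_sections_nonzero_iff:
  assumes P: "lattice_polytope P" "P \<noteq> {}"
  shows "adjoint_sections P \<noteq> {0} \<longleftrightarrow> interior P \<inter> range lattice_vec \<noteq> {}"
proof
  assume "interior P \<inter> range lattice_vec \<noteq> {}"
  then obtain m where "lattice_vec m \<in> interior P" by blast
  then have "character m \<in> adjoint_sections P"
    by (simp add: adjoint_sections_eq[OF assms] character_def)
  moreover have "character m \<noteq> 0"
    by (auto simp: character_def dest: arg_cong[where f = Poly_Mapping.keys])
  ultimately show "adjoint_sections P \<noteq> {0}" by blast
next
  assume "adjoint_sections P \<noteq> {0}"
  moreover have "0 \<in> adjoint_sections P" by (simp add: adjoint_sections_eq[OF assms])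
  ultimately obtain f where f: "f \<noteq> 0" "f \<in> adjoint_sections P" by blast
  from f(1) have "Poly_Mapping.keys f \<noteq> {}" by simp
  then obtain m where "m \<in> Poly_Mapping.keys f" by blast
  moreover have "lattice_vec ` Poly_Mapping.keys f \<subseteq> interior P"
    using f(2) by (simp only: adjoint_sections_eq[OF assms] mem_Collect_eq)
  ultimately have "lattice_vec m \<in> interior P \<inter> range lattice_vec" by blast
  then show "interior P \<inter> range lattice_vec \<noteq> {}" by blast
qed

lemma finite_bounded_lattice_points:
  assumes "bounded (S :: (real ^ 'n) set)"
  shows "finite {m. lattice_vec m \<in> S}"
proof -
  obtain B where B: "\<And>x. x \<in> S \<Longrightarrow> norm x \<le> B" using assms bounded_iff by blast
  have "{m. lattice_vec m \<in> S} \<subseteq> (\<lambda>f. vec_lambda f) ` (PiE UNIV (\<lambda>_. {- \<lceil>B\<rceil>..\<lceil>B\<rceil>}))"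
  proof
    fix m :: "int ^ 'n" assume "m \<in> {m. lattice_vec m \<in> S}"
    then have nB: "norm (lattice_vec m) \<le> B" using B by auto
    have "m $ i \<in> {- \<lceil>B\<rceil>..\<lceil>B\<rceil>}" for i
    proof -
      have "\<bar>real_of_int (m $ i)\<bar> \<le> B"
        using component_le_norm_cart[of "lattice_vec m" i] nB by (simp add: lattice_vec_def)
      then show ?thesis by (auto simp: abs_le_iff) linarith+
    qed
    then show "m \<in> (\<lambda>f. vec_lambda f) ` (PiE UNIV (\<lambda>_. {- \<lceil>B\<rceil>..\<lceil>B\<rceil>}))"
      by (intro image_eqI[of _ _ "vec_nth m"]) auto
  qed
  then show ?thesis by (rule finite_subset) (intro finite_imageI finite_PiE; simp)
qed

lemma dim_supported:
  fixes S :: "(int ^ 'n::finite) set"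
  assumes "finite S"
  shows "laurent.dim {f. Poly_Mapping.keys f \<subseteq> S} = card S"
proof (rule laurent.dim_unique[of "character ` S"])
  show "character ` S \<subseteq> {f. Poly_Mapping.keys f \<subseteq> S}" by (auto simp: character_def)
  have inj: "inj_on character S"
    by (auto simp: inj_on_def character_def dest!: arg_cong[where f = Poly_Mapping.keys])
  show "card (character ` S) = card S" by (rule card_image[OF inj])
  have look: "Poly_Mapping.lookup (\<Sum>m\<in>S. laurent_scale (u m) (character m)) j =
      (if j \<in> S then u j else 0)" for u j
  proof -
    have "Poly_Mapping.lookup (\<Sum>m\<in>S. laurent_scale (u m) (character m)) j =
        (\<Sum>m\<in>S. if m = j then u m else 0)"
      unfolding lookup_sum lookup_laurent_scale character_def lookup_single when_def
      by (intro sum.cong) auto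
    then show ?thesis using assms by simp
  qed
  show "{f. Poly_Mapping.keys f \<subseteq> S} \<subseteq> laurent.span (character ` S)"
  proof
    fix f :: "'n laurent" assume "f \<in> {f. Poly_Mapping.keys f \<subseteq> S}"
    then have "f = (\<Sum>m\<in>S. laurent_scale (Poly_Mapping.lookup f m) (character m))"
      by (intro poly_mapping_eqI) (auto simp: look in_keys_iff)
    also have "\<dots> \<in> laurent.span (character ` S)"
      by (intro laurent.span_sum laurent.span_scale laurent.span_base) auto
    finally show "f \<in> laurent.span (character ` S)" .
  qed
  show "laurent.independent (character ` S)"
  proof (rule laurent.independent_if_scalars_zero)
    show "finite (character ` S)" using assms by simp
    fix u x assume s: "(\<Sum>x\<in>character ` S. laurent_scale (u x) x) = 0" and x: "x \<in> character ` S"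
    then obtain j where j: "j \<in> S" "x = character j" by blast
    have "(\<Sum>m\<in>S. laurent_scale (u (character m)) (character m)) = 0"
      using s by (simp add: sum.reindex[OF inj])
    then show "u x = 0" using look[of "\<lambda>m. u (character m)" j] j by simp
  qed
qed

lemma dim_power_sections:
  assumes P: "lattice_polytope P" "P \<noteq> {}"
  shows "laurent.dim (power_sections P k) = card {m. lattice_vec m \<in> (\<lambda>y. real k *\<^sub>R y) ` P}"
proof -
  have "bounded ((\<lambda>y. real k *\<^sub>R y) ` P)"
    using lattice_polytope_compact[OF P(1)] by (simp add: compact_imp_bounded compact_scaling)
  then have "finite {m. lattice_vec m \<in> (\<lambda>y. real k *\<^sub>R y) ` P}"
    by (rule finite_bounded_lattice_points)
  moreover have "power_sections P k =
      {f. Poly_Mapping.keys f \<subseteq> {m. lattice_vec m \<in> (\<lambda>y. real k *\<^sub>R y) ` P}}"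
    unfolding power_sections_eq[OF assms] by auto
  ultimately show ?thesis by (simp add: dim_supported)
qed

lemma lattice_count_limit:
  fixes P :: "(real ^ 'n) set"
  assumes "convex P" "compact P"
  shows "(\<lambda>k. real (card {m. lattice_vec m \<in> (\<lambda>y. real k *\<^sub>R y) ` P}) / real k ^ CARD('n))
    \<longlonglongrightarrow> measure lborel P"
proof -
  define cell :: "nat \<Rightarrow> int ^ 'n \<Rightarrow> (real ^ 'n) set"
    where "cell k m = {x. \<forall>i. \<lfloor>real k * x $ i\<rfloor> = m $ i}" for k m
  define L where "L k = {m. lattice_vec m \<in> (\<lambda>y. real k *\<^sub>R y) ` P}" for k
  define S where "S k = (\<Union>m\<in>L k. cell k m)" for k
  have fin: "finite (L k)" for k
    unfolding L_def
    by (rule finite_bounded_lattice_points) (simp add: assms compact_imp_bounded compact_scaling)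
  have cell_meas: "cell k m \<in> sets lborel" for k m
  proof -
    have "cell k m = (\<Inter>i. (\<lambda>x. \<lfloor>real k * x $ i\<rfloor>) -` {m $ i} \<inter> space lborel)"
      by (auto simp: cell_def)
    moreover have "(\<lambda>x::real^'n. \<lfloor>real k * x $ i\<rfloor>) \<in> lborel \<rightarrow>\<^sub>M count_space UNIV" for i
      by measurable
    then have "(\<lambda>x::real^'n. \<lfloor>real k * x $ i\<rfloor>) -` {m $ i} \<inter> space lborel \<in> sets lborel" for i
      by (rule measurable_sets) simp
    ultimately show ?thesis by (simp only:) (intro sets.finite_INT; simp)
  qed
  have cell_vol: "emeasure lborel (cell k m) = ennreal (1 / real k ^ CARD('n))" if "k > 0" for k m
  proof -
    define a b :: "real ^ 'n" where "a = (1 / real k) *\<^sub>R lattice_vec m" and "b = (\<chi> i. (m $ i + 1) / real k)"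
    have vol: "(\<Prod>j\<in>Basis. (b - a) \<bullet> j) = 1 / real k ^ CARD('n)"
    proof -
      have "(b - a) \<bullet> j = 1 / real k" if j: "j \<in> Basis" for j
      proof -
        obtain i where "j = axis i 1" using j by (auto simp: Basis_vec_def)
        then show ?thesis
          by (simp add: a_def b_def lattice_vec_def inner_axis add_divide_distrib)
      qed
      then show ?thesis by (simp add: power_divide)
    qed
    have le: "\<forall>j\<in>Basis. a \<bullet> j \<le> b \<bullet> j"
      by (auto simp: a_def b_def lattice_vec_def Basis_vec_def inner_axis divide_right_mono)
    have iff: "x \<in> cell k m \<longleftrightarrow> (\<forall>i. a $ i \<le> x $ i \<and> x $ i < b $ i)" for x
      using that by (auto simp: cell_def a_def b_def lattice_vec_def floor_eq_iff field_simps)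
    have sub: "box a b \<subseteq> cell k m" "cell k m \<subseteq> cbox a b"
      by (auto simp: iff mem_box_cart less_imp_le)
    have "emeasure lborel (box a b) \<le> emeasure lborel (cell k m)"
      "emeasure lborel (cell k m) \<le> emeasure lborel (cbox a b)"
      using sub cell_meas by (auto intro!: emeasure_mono)
    moreover have "emeasure lborel (box a b) = ennreal (1 / real k ^ CARD('n))"
      "emeasure lborel (cbox a b) = ennreal (1 / real k ^ CARD('n))"
      using le vol by (simp_all add: emeasure_lborel_box_eq emeasure_lborel_cbox_eq)
    ultimately show ?thesis by simp
  qed
  have S_vol: "measure lborel (S k) = real (card (L k)) / real k ^ CARD('n)" if "k > 0" for k
  proof -
    have "measure lborel (S k) = (\<Sum>m\<in>L k. measure lborel (cell k m))"
      unfolding S_def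
    proof (rule measure_finite_Union)
      show "disjoint_family_on (cell k) (L k)"
        by (auto simp: disjoint_family_on_def cell_def vec_eq_iff)
    qed (use fin cell_meas cell_vol[OF that] in auto)
    also have "\<dots> = (\<Sum>m\<in>L k. 1 / real k ^ CARD('n))"
      by (intro sum.cong refl) (simp add: measure_def cell_vol[OF that])
    finally show ?thesis by simp
  qed
  define rnd :: "nat \<Rightarrow> real ^ 'n \<Rightarrow> real ^ 'n"
    where "rnd k x = (\<chi> i. of_int \<lfloor>real k * x $ i\<rfloor> / real k)" for k x
  have S_iff: "x \<in> S k \<longleftrightarrow> rnd k x \<in> P" if "k > 0" for k x
  proof -
    have "x \<in> S k \<longleftrightarrow> (\<chi> i. \<lfloor>real k * x $ i\<rfloor>) \<in> L k"
    proof
      assume "x \<in> S k"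
      then obtain m where m: "m \<in> L k" "\<forall>i. \<lfloor>real k * x $ i\<rfloor> = m $ i"
        by (auto simp: S_def cell_def)
      then have "(\<chi> i. \<lfloor>real k * x $ i\<rfloor>) = m" by (simp add: vec_eq_iff)
      with m show "(\<chi> i. \<lfloor>real k * x $ i\<rfloor>) \<in> L k" by simp
    next
      assume "(\<chi> i. \<lfloor>real k * x $ i\<rfloor>) \<in> L k"
      then show "x \<in> S k" unfolding S_def cell_def by force
    qed
    also have "\<dots> \<longleftrightarrow> real k *\<^sub>R rnd k x \<in> (\<lambda>y. real k *\<^sub>R y) ` P"
    proof -
      have "lattice_vec (\<chi> i. \<lfloor>real k * x $ i\<rfloor>) = real k *\<^sub>R rnd k x"
        using that by (simp add: lattice_vec_def rnd_def vec_eq_iff)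
      then show ?thesis by (simp add: L_def)
    qed
    also have "\<dots> \<longleftrightarrow> rnd k x \<in> P" using that by auto
    finally show ?thesis .
  qed
  have rnd_near: "norm (rnd k x - x) \<le> real CARD('n) / real k" if "k > 0" for k x
  proof -
    have "\<bar>(rnd k x - x) $ i\<bar> \<le> 1 / real k" for i
    proof -
      have "(rnd k x - x) $ i = (of_int \<lfloor>real k * x $ i\<rfloor> - real k * x $ i) / real k"
        using that by (simp add: rnd_def field_simps)
      moreover have "\<bar>of_int \<lfloor>real k * x $ i\<rfloor> - real k * x $ i\<bar> \<le> 1" by linarith
      ultimately show ?thesis using that by (simp add: divide_right_mono)
    qed
    then have "(\<Sum>i\<in>UNIV. \<bar>(rnd k x - x) $ i\<bar>) \<le> (\<Sum>i\<in>(UNIV::'n set). 1 / real k)"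
      by (intro sum_mono)
    then show ?thesis using norm_le_l1_cart[of "rnd k x - x"] by simp
  qed
  obtain B where B: "\<And>x. x \<in> P \<Longrightarrow> norm x \<le> B"
    using compact_imp_bounded[OF assms(2)] bounded_iff by blast
  let ?w = "indicator (cball 0 (B + real CARD('n))) :: real ^ 'n \<Rightarrow> real"
  have S_bound: "S (Suc k) \<subseteq> cball 0 (B + real CARD('n))" for k
  proof
    fix x assume "x \<in> S (Suc k)"
    then have "norm (rnd (Suc k) x) \<le> B" using B S_iff by blast
    moreover have "norm (rnd (Suc k) x - x) \<le> real CARD('n)"
      using rnd_near[of "Suc k" x] by (simp add: field_simps) (smt (verit) mult_nonneg_nonneg of_nat_0_le_iff)
    moreover have "norm x \<le> norm (rnd (Suc k) x) + norm (rnd (Suc k) x - x)"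
      by (metis norm_triangle_sub norm_minus_commute add.commute)
    ultimately show "x \<in> cball 0 (B + real CARD('n))" by simp
  qed
  have S_meas: "S k \<in> sets lborel" for k
    unfolding S_def using fin cell_meas by (intro sets.finite_UN) auto
  have P_meas: "P \<in> sets lborel" using assms(2) by (simp add: borel_compact)
  have frontier0: "frontier P \<in> null_sets lborel"
    using negligible_convex_frontier[OF assms(1)] by (simp add: negligible_iff_null_sets null_sets_completion_iff)
  have conv: "(\<lambda>k. indicator (S (Suc k)) x) \<longlonglongrightarrow> (indicator P x :: real)"
    if "x \<notin> frontier P" for x
  proof -
    have lim: "(\<lambda>k. rnd (Suc k) x) \<longlonglongrightarrow> x"
    proof -
      have "(\<lambda>k. real CARD('n) / real (Suc k)) \<longlonglongrightarrow> 0"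
        by (rule LIMSEQ_Suc[OF lim_const_over_n])
      then have "(\<lambda>k. rnd (Suc k) x - x) \<longlonglongrightarrow> 0"
        by (rule Lim_null_comparison[rotated]) (auto intro!: always_eventually rnd_near simp del: of_nat_Suc)
      then show ?thesis by (simp add: LIM_zero_iff)
    qed
    have "\<forall>\<^sub>F k in sequentially. (rnd (Suc k) x \<in> P) = (x \<in> P)"
    proof (cases "x \<in> P")
      case True
      then have "x \<in> interior P" using that assms(2)
        by (simp add: frontier_def compact_imp_closed)
      then have "\<forall>\<^sub>F k in sequentially. rnd (Suc k) x \<in> interior P"
        using lim open_interior topological_tendstoD by blast
      then show ?thesis using True interior_subset by (auto elim!: eventually_mono)
    next
      case False
      then have "\<forall>\<^sub>F k in sequentially. rnd (Suc k) x \<in> - P"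
        using lim assms(2) by (intro topological_tendstoD) (auto simp: compact_imp_closed open_Compl)
      then show ?thesis using False by (auto elim!: eventually_mono)
    qed
    then have "\<forall>\<^sub>F k in sequentially. indicator (S (Suc k)) x = (indicator P x :: real)"
      by eventually_elim (auto simp: indicator_def S_iff)
    then show ?thesis by (rule tendsto_eventually)
  qed
  have "(\<lambda>k. \<integral>x. indicator (S (Suc k)) x \<partial>lborel) \<longlonglongrightarrow> (\<integral>x. (indicator P x :: real) \<partial>lborel)"
  proof (rule integral_dominated_convergence[where w = ?w])
    show "integrable lborel ?w" by (intro integrable_real_indicator emeasure_bounded_finite) auto
    show "AE x in lborel. (\<lambda>k. indicator (S (Suc k)) x) \<longlonglongrightarrow> (indicator P x :: real)"
      using AE_not_in[OF frontier0] by eventually_elim (rule conv)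
    show "AE x in lborel. norm (indicator (S (Suc k)) x :: real) \<le> ?w x" for k
      using S_bound[of k] by (intro AE_I2) (auto simp: indicator_def)
  qed (use S_meas P_meas in auto)
  then have "(\<lambda>k. measure lborel (S (Suc k))) \<longlonglongrightarrow> measure lborel P" by simp
  then have "(\<lambda>k. real (card (L (Suc k))) / real (Suc k) ^ CARD('n)) \<longlonglongrightarrow> measure lborel P"
    by (simp add: S_vol del: of_nat_Suc power_Suc)
  then show ?thesis unfolding L_def by (rule LIMSEQ_imp_Suc)
qed

lemma polarization_degree_eq:
  fixes P :: "(real ^ 'n) set"
  assumes P: "lattice_polytope P" "P \<noteq> {}"
  shows "polarization_degree P = fact CARD('n) * measure lborel P"
proof -
  have "(\<lambda>k. fact CARD('n) * (real (laurent.dim (power_sections P k)) / real k ^ CARD('n)))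
      \<longlonglongrightarrow> fact CARD('n) * measure lborel P"
    unfolding dim_power_sections[OF assms]
    using lattice_polytope_convex lattice_polytope_compact P
    by (intro tendsto_mult tendsto_const lattice_count_limit) auto
  then show ?thesis unfolding polarization_degree_def by (intro limI) simp
qed

lemma delta_genus_eq:
  fixes P :: "(real ^ 'n) set"
  assumes P: "lattice_polytope P" "P \<noteq> {}"
  shows "delta_genus P = real CARD('n) + fact CARD('n) * measure lborel P
    - real (card {m. lattice_vec m \<in> P})"
  unfolding delta_genus_def polarization_degree_eq[OF assms] dim_power_sections[OF assms] by simp

end

theory Submission
  imports Defs
begin

text \<open>
  Move an interior lattice point of \<open>P = conv V\<close> to the origin and triangulate the boundary of \<open>P\<close>
  without new vertices; let \<open>T\<close> be the resulting complete simplicial fan and \<open>W\<close> its set of rays.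
  Around each ray a complete fan has at least \<open>n\<close> cones, and each cone has \<open>n\<close> rays, so
  \<open>|W| \<le> |T|\<close>. Splitting a lattice simplex successively at the other lattice points in it shows that its
  normalized volume is at least one plus the number of these points. Summing over the simplices
  \<open>conv (0, \<sigma>)\<close>, \<open>\<sigma> \<in> T\<close>, gives \<open>n! vol P \<ge> |T| + |P \<inter> M - (W \<union> {0})| \<ge> |P \<inter> M| - 1\<close>.

  In the case of equality with \<open>n \<ge> 3\<close>, every ray lies in exactly \<open>n\<close> cones, which forces \<open>|W| = n + 1\<close>,
  and a lattice point outside \<open>W\<close> and \<open>0\<close> would be counted twice or would split its simplex into too many
  pieces. So all the simplices are unimodular, and \<open>P\<close> is the mirror simplex.
\<close>

section \<open>Normalized volume of lattice simplices\<close>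

text \<open>Volume and lattice points are compared inside each simplex separately; only the rays,
  which many simplices share, need the global estimate \<open>|W| \<le> |T|\<close>. The bound for
  the cones around a ray behind it is linear algebra, not induction on links: \<open>d\<close>
  functionals on a \<open>d\<close>-dimensional space are simultaneously nonpositive at some nonzero
  vector. A fan can therefore be kept as a bare set of generator sets.

  Points of \<open>V\<close> need not be vertices of \<open>P\<close> and need not become rays. A
  lattice point that is no ray is charged to the volume of a simplex containing it; counting it in
  several simplices only strengthens the lower bound for the volume.

  The restriction \<open>n \<ge> 3\<close> is real. In the plane every complete fan has as many rays
  as cones, and by Pick's formula \<open>\<Delta>\<close> is the number of interior lattice points,
  so equality holds for every lattice polygon with exactly one of them. For
  \<open>n \<ge> 3\<close>, three rays fit into one cone, and an edge of
  \<open>conv (0, \<sigma>)\<close> lies in a facet through 0.\<close>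

text \<open>
  The library computes volumes of linear images and of simplices only for index types of class
  \<^class>\<open>wellorder\<close>, so they are transported to an arbitrary finite index type along a well-ordered copy of it.
\<close>

typedef 'a ordered_copy = "UNIV :: 'a set" by blast

instance ordered_copy :: (finite) finite
proof
  have "(UNIV :: 'a ordered_copy set) = range Abs_ordered_copy"
    by (metis UNIV_eq_I Rep_ordered_copy_inverse rangeI)
  then show "finite (UNIV :: 'a ordered_copy set)"
    by (metis finite finite_imageI)
qed

instantiation ordered_copy :: (finite) wellorder
begin

definition rank_ordered_copy :: "'a ordered_copy \<Rightarrow> nat"
  where "rank_ordered_copy = (SOME f. inj f)"

definition "x \<le> y \<longleftrightarrow> rank_ordered_copy x \<le> rank_ordered_copy y" for x y :: "'a ordered_copy"

definition "x < y \<longleftrightarrow> rank_ordered_copy x < rank_ordered_copy y" for x y :: "'a ordered_copy"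

instance
proof
  have "\<exists>f :: 'a ordered_copy \<Rightarrow> nat. inj f"
    using finite_imp_inj_to_nat_seg[OF finite_class.finite_UNIV] by blast
  then have inj: "inj (rank_ordered_copy :: 'a ordered_copy \<Rightarrow> nat)"
    unfolding rank_ordered_copy_def by (rule someI_ex)
  fix x y z :: "'a ordered_copy"
  show "(x < y) = (x \<le> y \<and> \<not> y \<le> x)" "x \<le> x" "x \<le> y \<or> y \<le> x"
    by (auto simp: less_eq_ordered_copy_def less_ordered_copy_def)
  show "x \<le> y \<Longrightarrow> y \<le> z \<Longrightarrow> x \<le> z"
    by (auto simp: less_eq_ordered_copy_def)
  show "x \<le> y \<Longrightarrow> y \<le> x \<Longrightarrow> x = y"
    using inj by (auto simp: less_eq_ordered_copy_def inj_def)
next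
  fix P :: "'a ordered_copy \<Rightarrow> bool" and a
  assume "\<And>x. (\<And>y. y < x \<Longrightarrow> P y) \<Longrightarrow> P x"
  then show "P a"
    unfolding less_ordered_copy_def
    by (rule measure_induct_rule[where f = rank_ordered_copy and P = P]) blast
qed

end

definition reindex :: "real ^ 'n \<Rightarrow> real ^ 'n ordered_copy"
  where "reindex x = (\<chi> i. x $ Rep_ordered_copy i)"

lemma linear_reindex: "linear (reindex :: real ^ 'n::finite \<Rightarrow> _)"
  by (rule linearI) (simp_all add: reindex_def vec_eq_iff)

lemma bij_ordered_copy: "bij (Rep_ordered_copy :: 'n ordered_copy \<Rightarrow> 'n)"
  by (metis Rep_ordered_copy_inverse Abs_ordered_copy_inverse UNIV_I bij_iff)

lemma card_ordered_copy: "CARD('n::finite ordered_copy) = CARD('n)"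
  using bij_betw_same_card[OF bij_ordered_copy] .

lemma reindex_nth: "reindex x $ i = x $ Rep_ordered_copy i"
  by (simp add: reindex_def)

lemma bij_reindex: "bij (reindex :: real ^ 'n::finite \<Rightarrow> _)"
proof (rule bijI')
  fix x y :: "real ^ 'n"
  show "reindex x = reindex y \<longleftrightarrow> x = y"
    by (metis Abs_ordered_copy_inverse UNIV_I reindex_nth vec_eq_iff)
next
  fix y :: "real ^ 'n ordered_copy"
  show "\<exists>x. y = reindex x"
    by (rule exI[of _ "\<chi> i. y $ Abs_ordered_copy i"])
      (simp add: vec_eq_iff reindex_def Rep_ordered_copy_inverse)
qed

lemma prod_Basis_vec: "(\<Prod>b\<in>Basis. (x :: real ^ 'n) \<bullet> b) = (\<Prod>i\<in>UNIV. x $ i)"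
proof -
  have eq: "(Basis :: (real ^ 'n) set) = (\<lambda>i. axis i 1) ` UNIV" by (auto simp: Basis_vec_def)
  show ?thesis unfolding eq
    by (subst prod.reindex) (auto simp: inj_on_def axis_eq_axis inner_axis)
qed

lemma borel_measurable_reindex [measurable]: "(reindex :: real ^ 'n::finite \<Rightarrow> _) \<in> borel \<rightarrow>\<^sub>M borel"
  using linear_continuous_on[OF linear_reindex[unfolded linear_conv_bounded_linear]]
  by (rule borel_measurable_continuous_onI)

text \<open>Renaming coordinates carries boxes to boxes with the same side lengths, and
  \<open>lborel\<close> is characterised by its values on boxes.\<close>

lemma distr_reindex: "distr lborel borel reindex = (lborel :: (real ^ 'n::finite ordered_copy) measure)"
proof (rule lborel_eqI[symmetric])
  fix l u :: "real ^ 'n ordered_copy"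
  assume le: "\<And>b. b \<in> Basis \<Longrightarrow> l \<bullet> b \<le> u \<bullet> b"
  define l' u' :: "real ^ 'n" where "l' = (\<chi> i. l $ Abs_ordered_copy i)" and "u' = (\<chi> i. u $ Abs_ordered_copy i)"
  have l': "l $ i \<le> u $ i" for i
    using le[OF axis_in_Basis_iff[THEN iffD2], of 1 i] by (simp add: inner_axis)
  have "reindex -` box l u = box l' u'"
  proof (rule set_eqI)
    fix x
    show "x \<in> reindex -` box l u \<longleftrightarrow> x \<in> box l' u'"
      by (simp add: mem_box_cart reindex_nth l'_def u'_def)
        (metis Rep_ordered_copy_inverse Abs_ordered_copy_inverse UNIV_I)
  qed
  then have "emeasure (distr lborel borel reindex) (box l u) = emeasure lborel (box l' u')"
    by (simp add: emeasure_distr borel_measurable_reindex)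
  also have "\<dots> = (\<Prod>b\<in>Basis. (u' - l') \<bullet> b)"
    using l' by (intro emeasure_lborel_box) (auto simp: Basis_vec_def inner_axis l'_def u'_def)
  also have "(\<Prod>b\<in>Basis. (u' - l') \<bullet> b) = (\<Prod>i\<in>UNIV. (u' - l') $ i)" by (rule prod_Basis_vec)
  also have "\<dots> = (\<Prod>i\<in>UNIV. (u - l) $ i)"
    by (subst prod.reindex_bij_betw[OF bij_ordered_copy, symmetric])
      (simp add: l'_def u'_def Rep_ordered_copy_inverse)
  finally show "emeasure (distr lborel borel reindex) (box l u) = (\<Prod>b\<in>Basis. (u - l) \<bullet> b)"
    by (simp add: prod_Basis_vec)
qed simp

lemma content_reindex:
  fixes S :: "(real ^ 'n::finite) set"
  assumes "finite S"
  shows "measure lborel (convex hull (reindex ` S)) = measure lborel (convex hull S)"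
proof -
  have "measure lborel (convex hull (reindex ` S)) = measure (distr lborel borel reindex) (reindex ` (convex hull S))"
    by (simp add: distr_reindex convex_hull_linear_image[OF linear_reindex])
  also have "\<dots> = measure lborel (reindex -` reindex ` (convex hull S) \<inter> space (lborel :: (real ^ 'n) measure))"
    using assms borel_measurable_reindex
    by (intro measure_distr)
      (auto simp: convex_hull_linear_image[OF linear_reindex] intro: borel_compact finite_imp_compact_convex_hull)
  finally show ?thesis
    by (simp add: inj_vimage_image_eq[OF bij_is_inj[OF bij_reindex]])
qed

text \<open>The scaling gives unimodular simplices the value 1. The argument is a set of vertices
  rather than a polytope because simplices are varied by exchanging vertices.\<close>

definition normalized_volume :: "(real ^ 'n::finite) set \<Rightarrow> real"
  where "normalized_volume S = fact CARD('n) * measure lborel (convex hull S)"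

lemma normalized_volume_reindex:
  "finite S \<Longrightarrow> normalized_volume (reindex ` S) = normalized_volume S"
  by (simp add: normalized_volume_def content_reindex card_ordered_copy)

section \<open>Lattice points and vertex exchange in a simplex\<close>

abbreviation lattice :: "(real ^ 'n) set"
  where "lattice \<equiv> range lattice_vec"

lemma mem_lattice_iff: "x \<in> lattice \<longleftrightarrow> (\<forall>i. x $ i \<in> \<int>)"
proof
  assume "\<forall>i. x $ i \<in> \<int>"
  then have "x = lattice_vec (\<chi> i. \<lfloor>x $ i\<rfloor>)" by (simp add: lattice_vec_def vec_eq_iff)
  then show "x \<in> lattice" by blast
qed (auto simp: lattice_vec_def)

lemma det_in_Ints:
  fixes A :: "real ^ 'n ^ 'n"
  assumes "\<And>i j. A $ i $ j \<in> \<int>"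
  shows "det A \<in> \<int>"
  unfolding det_def using assms by (intro Ints_sum Ints_mult Ints_prod Ints_of_int) auto

lemma bij_betw_UNIV_exists:
  assumes "finite S" "card S = CARD('n::finite)"
  obtains f :: "'n::finite \<Rightarrow> 'b" where "bij_betw f UNIV S"
  using assms finite_same_card_bij[of "UNIV :: 'n set" S] by auto

lemma normalized_volume_det:
  fixes S :: "(real ^ 'n::{finite,wellorder}) set"
  assumes "finite S" "x0 \<in> S" "bij_betw f UNIV (S - {x0})"
  shows "normalized_volume S = \<bar>det (\<chi> i j. f j $ i - x0 $ i)\<bar>"
proof -
  have "card (S - {x0}) = CARD('n)" using bij_betw_same_card[OF assms(3)] by simp
  then have "card S = Suc CARD('n)" using card_Suc_Diff1[OF assms(1,2)] by simp
  from content_simplex[OF assms(1) this assms(2,3)] show ?thesis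
    by (simp add: normalized_volume_def)
qed

lemma normalized_volume_in_Ints:
  fixes S :: "(real ^ 'n::finite) set"
  assumes "finite S" "card S = Suc CARD('n)" "S \<subseteq> lattice"
  shows "normalized_volume S \<in> \<int>"
proof -
  define R where "R = reindex ` S"
  have R: "finite R" "card R = Suc CARD('n)" 
    using assms by (auto simp: R_def card_image inj_on_subset[OF bij_is_inj[OF bij_reindex]])
  have RL: "x $ i \<in> \<int>" if "x \<in> R" for x i
    using that assms(3) mem_lattice_iff by (force simp: R_def reindex_nth)
  obtain x0 where x0: "x0 \<in> R" using R by fastforce
  then have "card (R - {x0}) = CARD('n ordered_copy)" using R by (simp add: card_ordered_copy)
  then obtain f :: "'n ordered_copy \<Rightarrow> _" where f: "bij_betw f UNIV (R - {x0})"
    using R bij_betw_UNIV_exists[of "R - {x0}"] by blast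
  have "f j \<in> R" for j using f by (auto simp: bij_betw_def)
  then have "det (\<chi> i j. f j $ i - x0 $ i) \<in> \<int>"
    using x0 RL by (intro det_in_Ints) auto
  then have "normalized_volume R \<in> \<int>"
    unfolding normalized_volume_det[OF R(1) x0 f] by simp
  then show ?thesis unfolding R_def using normalized_volume_reindex[OF assms(1)] by simp
qed

text \<open>Cramer's rule: in terms of the edges at a fixed vertex \<open>x0\<close>, putting
  \<open>x\<close> in place of \<open>s\<close> replaces one column of the edge matrix
  \<open>A\<close> by \<open>A *v w\<close>, where \<open>w\<close> holds the barycentric
  coordinates of \<open>x\<close>. They may be negative, so \<open>x\<close> may lie outside the
  simplex.\<close>

lemma normalized_volume_replace_wellorder:
  fixes S :: "(real ^ 'n::{finite,wellorder}) set"
  assumes S: "finite S" "card S = Suc CARD('n)" "s \<in> S"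
    and u: "sum u S = 1" "x = (\<Sum>t\<in>S. u t *\<^sub>R t)" and x: "x \<notin> S - {s}"
  shows "normalized_volume (insert x (S - {s})) = \<bar>u s\<bar> * normalized_volume S"
proof -
  have "S - {s} \<noteq> {}"
  proof
    assume "S - {s} = {}"
    then have "card (S - {s}) = 0" by (simp only: card.empty)
    moreover have "card (S - {s}) = CARD('n)" using card_Suc_Diff1[OF S(1,3)] S(2) by simp
    ultimately show False by simp
  qed
  \<comment> \<open>The base vertex has to survive the exchange, so that \<open>s\<close> is the end
    of one of its edges.\<close>
  then obtain x0 where x0: "x0 \<in> S" "x0 \<noteq> s" by blast
  then have "card (S - {x0}) = CARD('n)" using S by (simp)
  then obtain f :: "'n \<Rightarrow> _" where f: "bij_betw f UNIV (S - {x0})"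
    using S bij_betw_UNIV_exists[of "S - {x0}"] by blast
  define k where "k = inv f s"
  have inj: "inj f" and ran: "range f = S - {x0}" using f by (auto simp: bij_betw_def)
  have fk: "f k = s" unfolding k_def using ran x0 S by (intro f_inv_into_f) auto
  define g where "g = f(k := x)"
  let ?S = "insert x (S - {s})"
  have "x0 \<noteq> x" using x x0 by auto
  have g: "bij_betw g UNIV (?S - {x0})"
  proof (rule bij_betw_imageI)
    show "inj g"
      using inj x fk ran \<open>x0 \<noteq> x\<close> unfolding g_def inj_def
      by (metis Diff_iff fun_upd_apply rangeI singletonD)
    have "range g = insert x (f ` (UNIV - {k}))" unfolding g_def by (auto simp: image_iff)
    also have "f ` (UNIV - {k}) = S - {x0} - {s}"
      using inj ran fk by (simp add: image_set_diff)
    finally show "range g = ?S - {x0}" using \<open>x0 \<noteq> x\<close> by auto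
  qed
  define A :: "real ^ ('n::_) ^ ('n::_)" where "A = (\<chi> i j. f j $ i - x0 $ i)"
  define w :: "real ^ ('n::_)" where "w = (\<chi> j. u (f j))"
  have "(\<Sum>t\<in>S. u t *\<^sub>R (t - x0)) = x - x0"
    using u by (simp add: scaleR_diff_right sum_subtractf flip: scaleR_left.sum)
  moreover have "(\<Sum>t\<in>S. u t *\<^sub>R (t - x0)) = (\<Sum>t\<in>S - {x0}. u t *\<^sub>R (t - x0))"
    using S x0 by (intro sum.mono_neutral_right) auto
  moreover have "\<dots> = (\<Sum>j\<in>UNIV. u (f j) *\<^sub>R (f j - x0))"
    by (rule sum.reindex_bij_betw[OF f, symmetric])
  ultimately have "x - x0 = (\<Sum>j\<in>UNIV. u (f j) *\<^sub>R (f j - x0))" by simp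
  then have Aw: "A *v w = x - x0"
    by (simp add: vec_eq_iff A_def w_def matrix_vector_mult_def mult.commute)
  have "(\<chi> i j. g j $ i - x0 $ i) = (\<chi> i j. if j = k then (A *v w) $ i else A $ i $ j)"
    unfolding Aw by (simp add: vec_eq_iff g_def A_def)
  then have "det (\<chi> i j. g j $ i - x0 $ i) = u s * det A"
    using cramer_lemma[of k A w] by (simp add: w_def fk)
  moreover have "normalized_volume ?S = \<bar>det (\<chi> i j. g j $ i - x0 $ i)\<bar>"
    using S x0 by (intro normalized_volume_det g) auto
  moreover have "normalized_volume S = \<bar>det A\<bar>"
    unfolding A_def using S x0 by (intro normalized_volume_det f) auto
  ultimately show ?thesis by (simp add: abs_mult)
qed

text \<open>Besides subdivision at a point of the simplex, this yields the coefficients of the last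
  ray in \<open>tight_simplex\<close>, the integrality of coordinates in a unimodular basis, and the
  volume of the mirror simplex.\<close>

lemma normalized_volume_replace:
  fixes S :: "(real ^ 'n::finite) set"
  assumes S: "finite S" "card S = Suc CARD('n)" "s \<in> S"
    and u: "sum u S = 1" "x = (\<Sum>t\<in>S. u t *\<^sub>R t)" and x: "x \<notin> S - {s}"
  shows "normalized_volume (insert x (S - {s})) = \<bar>u s\<bar> * normalized_volume S"
proof -
  have inj: "inj (reindex :: real ^ 'n \<Rightarrow> _)" by (rule bij_is_inj[OF bij_reindex])
  define v where "v = u \<circ> inv reindex"
  have v: "v (reindex t) = u t" for t by (simp add: v_def inv_f_f[OF inj])
  have "normalized_volume (insert (reindex x) (reindex ` S - {reindex s})) = \<bar>v (reindex s)\<bar> * normalized_volume (reindex ` S)"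
  proof (rule normalized_volume_replace_wellorder)
    show "card (reindex ` S) = Suc CARD('n ordered_copy)"
      using S by (simp add: card_image inj_on_subset[OF inj] card_ordered_copy)
    show "sum v (reindex ` S) = 1" using u by (simp add: sum.reindex inj_on_subset[OF inj] v)
    show "reindex x = (\<Sum>t\<in>reindex ` S. v t *\<^sub>R t)"
      using u by (simp add: sum.reindex inj_on_subset[OF inj] v linear_sum[OF linear_reindex] linear_cmul[OF linear_reindex])
    show "reindex x \<notin> reindex ` S - {reindex s}"
      using x inj by (auto simp: inj_def)
  qed (use S in auto)
  moreover have "insert (reindex x) (reindex ` S - {reindex s}) = reindex ` (insert x (S - {s}))"
    using inj by (auto simp: inj_def)
  ultimately show ?thesis using S by (simp add: v normalized_volume_reindex del: image_insert)
qed

section \<open>Star subdivision of a simplex\<close>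

lemma mem_convex_hull_insert:
  fixes S :: "'a::real_vector set"
  assumes "finite S" "0 \<le> r" "\<And>t. t \<in> S \<Longrightarrow> 0 \<le> c t" "r + sum c S = 1"
  shows "r *\<^sub>R x + (\<Sum>t\<in>S. c t *\<^sub>R t) \<in> convex hull (insert x S)"
proof -
  \<comment> \<open>The weights live on an option type: if \<open>x\<close> is itself a point of
    \<open>S\<close>, its two weights stay separate summands.\<close>
  define d where "d = (\<lambda>o'. case o' of None \<Rightarrow> r | Some t \<Rightarrow> c t)"
  define p where "p = (\<lambda>o'. case o' of None \<Rightarrow> x | Some t \<Rightarrow> t)"
  have sI: "sum f (insert None (Some ` S)) = f None + (\<Sum>t\<in>S. f (Some t))" for f :: "'a option \<Rightarrow> 'b::comm_monoid_add"
    using assms(1) by (subst sum.insert) (auto simp: sum.reindex)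
  have "(\<Sum>i\<in>insert None (Some ` S). d i *\<^sub>R p i) \<in> convex hull (insert x S)"
  proof (rule convex_sum[OF _ convex_convex_hull])
    show "finite (insert None (Some ` S))" using assms(1) by simp
    show "sum d (insert None (Some ` S)) = 1" unfolding sI using assms(4) by (simp add: d_def)
    show "0 \<le> d i" if "i \<in> insert None (Some ` S)" for i using that assms by (auto simp: d_def)
    show "p i \<in> convex hull (insert x S)" if "i \<in> insert None (Some ` S)" for i
      using that by (auto simp: p_def intro: hull_inc)
  qed
  then show ?thesis unfolding sI by (simp add: d_def p_def)
qed

text \<open>The ratio test of linear programming: if \<open>y\<close> has weights \<open>w\<close>,
  the largest multiple of \<open>x\<close> that can be subtracted with all weights staying
  nonnegative is the least ratio \<open>w s / u s\<close> over the support of \<open>u\<close>, and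
  at a minimizing \<open>s\<close> the remaining weight is 0.\<close>

lemma convex_hull_replace_cover:
  fixes S :: "'a::real_vector set"
  assumes S: "finite S" and u: "\<And>s. s \<in> S \<Longrightarrow> 0 \<le> u s" "sum u S = 1"
    and y: "y \<in> convex hull S"
  shows "\<exists>s\<in>S. 0 < u s \<and> y \<in> convex hull (insert (\<Sum>t\<in>S. u t *\<^sub>R t) (S - {s}))"
proof -
  define x where "x = (\<Sum>t\<in>S. u t *\<^sub>R t)"
  obtain w where w: "\<And>s. s \<in> S \<Longrightarrow> 0 \<le> w s" "sum w S = 1" "(\<Sum>t\<in>S. w t *\<^sub>R t) = y"
    using y unfolding convex_hull_finite[OF S] by blast
  define U where "U = {s\<in>S. 0 < u s}"
  have "U \<noteq> {}"
  proof
    assume "U = {}"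
    then have "u s = 0" if "s \<in> S" for s using u(1)[OF that] that by (force simp: U_def)
    then show False using u(2) by simp
  qed
  moreover have "finite U" using S by (simp add: U_def)
  ultimately obtain s where s: "s \<in> U" "\<And>t. t \<in> U \<Longrightarrow> w s / u s \<le> w t / u t"
    using ex_min_if_finite[of "(\<lambda>s. w s / u s) ` U"] by (force simp: not_less)
  define r where "r = w s / u s"
  have sS: "s \<in> S" "0 < u s" using s by (auto simp: U_def)
  have r: "0 \<le> r" using sS w(1) by (simp add: r_def)
  define c where "c t = w t - r * u t" for t
  have c: "0 \<le> c t" if "t \<in> S" for t
  proof (cases "t \<in> U")
    case True
    then have "r \<le> w t / u t" "0 < u t" using s by (auto simp: r_def U_def)
    then show ?thesis by (simp add: c_def field_simps)
  next
    case False
    then have "u t = 0" using u(1)[OF that] that by (auto simp: U_def)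
    then show ?thesis using w(1)[OF that] by (simp add: c_def)
  qed
  have c0: "c s = 0" using sS by (simp add: c_def r_def)
  have "sum c S = 1 - r" using u w by (simp add: c_def sum_subtractf flip: sum_distrib_left)
  then have csum: "sum c (S - {s}) = 1 - r" using S sS c0 by (simp add: sum_diff1)
  have "(\<Sum>t\<in>S. c t *\<^sub>R t) = y - r *\<^sub>R x"
    using w by (simp add: c_def x_def scaleR_diff_left sum_subtractf scaleR_sum_right)
  then have yx: "y = r *\<^sub>R x + (\<Sum>t\<in>S - {s}. c t *\<^sub>R t)" using S sS c0 by (simp add: sum_diff1)
  have "y \<in> convex hull (insert x (S - {s}))"
    unfolding yx using S r c csum by (intro mem_convex_hull_insert) auto
  then show ?thesis using sS unfolding x_def by blast
qed

text \<open>The pieces at the vertices \<open>s\<close> in the support of \<open>x\<close> have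
  volumes \<open>u s\<close> times that of \<open>S\<close>, which add up to it, and together they
  contain all other points of \<open>X\<close>. The bound for the pieces is a hypothesis, so that
  this step serves inside the induction as well as after it.\<close>

lemma normalized_volume_ge_support_aux:
  fixes S :: "(real ^ 'n::finite) set"
  assumes S: "finite S" "card S = Suc CARD('n)" "0 < normalized_volume S"
    and X: "finite X" "X \<subseteq> convex hull S - S" "x \<in> X"
    and u: "\<And>s. s \<in> S \<Longrightarrow> 0 \<le> u s" "sum u S = 1" "x = (\<Sum>t\<in>S. u t *\<^sub>R t)"
    and pieces: "\<And>s. s \<in> S \<Longrightarrow> 0 < u s \<Longrightarrow>
      1 + real (card ((X - {x}) \<inter> convex hull (insert x (S - {s})))) \<le> normalized_volume (insert x (S - {s}))"
  shows "real (card {s\<in>S. 0 < u s}) + real (card X) - 1 \<le> normalized_volume S"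
proof -
  define U where "U = {s\<in>S. 0 < u s}"
  have U: "finite U" using S by (simp add: U_def)
  define piece where "piece s = insert x (S - {s})" for s
  have vol: "normalized_volume (piece s) = u s * normalized_volume S" if "s \<in> S" for s
    using normalized_volume_replace[OF S(1,2) that u(2,3)] u(1)[OF that] X by (auto simp: piece_def)
  have "sum u U = sum u S"
    using S u(1) by (intro sum.mono_neutral_left) (force simp: U_def)+
  then have "normalized_volume S = (\<Sum>s\<in>U. normalized_volume (piece s))"
    using u(2) vol by (simp add: U_def flip: sum_distrib_right)
  also have "\<dots> \<ge> (\<Sum>s\<in>U. 1 + real (card ((X - {x}) \<inter> convex hull piece s)))"
    by (intro sum_mono) (use pieces in \<open>auto simp: U_def piece_def\<close>)
  also have "(\<Sum>s\<in>U. 1 + real (card ((X - {x}) \<inter> convex hull piece s)))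
      = real (card U) + real (\<Sum>s\<in>U. card ((X - {x}) \<inter> convex hull piece s))"
    by (simp add: sum.distrib)
  finally have ge: "real (card U) + real (\<Sum>s\<in>U. card ((X - {x}) \<inter> convex hull piece s)) \<le> normalized_volume S" .
  have "X - {x} \<subseteq> (\<Union>s\<in>U. (X - {x}) \<inter> convex hull piece s)"
  proof
    fix y assume y: "y \<in> X - {x}"
    then have "y \<in> convex hull S" using X by blast
    from convex_hull_replace_cover[OF S(1) u(1,2) this] y
    show "y \<in> (\<Union>s\<in>U. (X - {x}) \<inter> convex hull piece s)"
      by (auto simp: U_def piece_def u(3))
  qed
  then have "card (X - {x}) \<le> card (\<Union>s\<in>U. (X - {x}) \<inter> convex hull piece s)"
    using U X by (intro card_mono) auto
  also have "\<dots> \<le> (\<Sum>s\<in>U. card ((X - {x}) \<inter> convex hull piece s))"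
    by (rule card_UN_le[OF U])
  finally have "card X \<le> 1 + (\<Sum>s\<in>U. card ((X - {x}) \<inter> convex hull piece s))"
    using X by simp
  then have "real (card X) \<le> real (1 + (\<Sum>s\<in>U. card ((X - {x}) \<inter> convex hull piece s)))"
    by (rule of_nat_mono)
  then show ?thesis using ge by (simp add: U_def)
qed

lemma normalized_volume_piece:
  fixes S :: "(real ^ 'n::finite) set"
  assumes S: "finite S" "card S = Suc CARD('n)" "S \<subseteq> lattice" "0 < normalized_volume S"
    and x: "x \<in> lattice" "x \<notin> S" "s \<in> S"
    and u: "sum u S = 1" "x = (\<Sum>t\<in>S. u t *\<^sub>R t)" "0 < u s"
  shows "finite (insert x (S - {s}))" "card (insert x (S - {s})) = Suc CARD('n)"
    "insert x (S - {s}) \<subseteq> lattice" "0 < normalized_volume (insert x (S - {s}))"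
  using assms normalized_volume_replace[OF S(1,2) x(3) u(1,2)] by auto

text \<open>Induction on the number of points, splitting at one of them. A point that is not a
  vertex has at least two vertices in its support, so there are at least two pieces; each
  contributes 1, and the second one pays for the splitting point.\<close>

lemma normalized_volume_ge:
  fixes S :: "(real ^ 'n::finite) set"
  assumes S: "finite S" "card S = Suc CARD('n)" "S \<subseteq> lattice" "0 < normalized_volume S"
    and X: "finite X" "X \<subseteq> lattice" "X \<subseteq> convex hull S - S"
  shows "1 + real (card X) \<le> normalized_volume S"
  using assms
proof (induction "card X" arbitrary: X S rule: less_induct)
  case less
  note S = less.prems(1-4) and X = less.prems(5-7)
  show ?case
  proof (cases "X = {}")
    case True
    \<comment> \<open>Integrality turns positivity of the volume into the bound 1.\<close>
    obtain k where k: "normalized_volume S = of_int k"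
      using normalized_volume_in_Ints[OF S(1-3)] by (rule Ints_cases)
    then show ?thesis using True S(4) by simp
  next
    case False
    then obtain x where x: "x \<in> X" by blast
    then obtain u where u: "\<And>s. s \<in> S \<Longrightarrow> 0 \<le> u s" "sum u S = 1" "x = (\<Sum>t\<in>S. u t *\<^sub>R t)"
      using X unfolding convex_hull_finite[OF S(1)] by blast
    have xS: "x \<in> lattice" "x \<notin> S" using x X by auto
    have "real (card {s\<in>S. 0 < u s}) + real (card X) - 1 \<le> normalized_volume S"
    proof (rule normalized_volume_ge_support_aux[OF S(1,2,4) X(1,3) x u])
      fix s assume s: "s \<in> S" "0 < u s"
      note piece = normalized_volume_piece[OF S xS s(1) u(2,3) s(2)]
      show "1 + real (card ((X - {x}) \<inter> convex hull (insert x (S - {s})))) \<le> normalized_volume (insert x (S - {s}))"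
      proof (rule less.hyps[OF _ piece])
        have "(X - {x}) \<inter> convex hull (insert x (S - {s})) \<subseteq> X - {x}" by blast
        then show "card ((X - {x}) \<inter> convex hull (insert x (S - {s}))) < card X"
          using x X by (metis card_Diff1_less card_mono finite_Diff le_less_trans)
      qed (use X in auto)
    qed auto
    moreover have "2 \<le> card {s\<in>S. 0 < u s}"
    proof (rule ccontr)
      let ?U = "{s\<in>S. 0 < u s}"
      assume "\<not> 2 \<le> card ?U"
      moreover have sU: "sum u ?U = 1" "(\<Sum>t\<in>?U. u t *\<^sub>R t) = x"
        using u(1) S(1) by (force simp: u(2)[symmetric] u(3) intro!: sum.mono_neutral_left)+
      moreover have "?U \<noteq> {}" using sU by force
      moreover have "finite ?U" using S(1) by simp
      ultimately have "card ?U = 1" by (simp add: card_gt_0_iff le_antisym not_less_eq_eq numeral_2_eq_2 Suc_leI)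
      then obtain s where "?U = {s}" by (rule card_1_singletonE)
      then have "x = s" "s \<in> S" using sU by auto
      then show False using xS by blast
    qed
    ultimately show ?thesis by linarith
  qed
qed

text \<open>Keeps the exact number of pieces: in the equality case this bounds the support of every
  further lattice point by two vertices.\<close>

lemma normalized_volume_ge_support:
  fixes S :: "(real ^ 'n::finite) set"
  assumes S: "finite S" "card S = Suc CARD('n)" "S \<subseteq> lattice" "0 < normalized_volume S"
    and X: "finite X" "X \<subseteq> lattice" "X \<subseteq> convex hull S - S" "x \<in> X"
    and u: "\<And>s. s \<in> S \<Longrightarrow> 0 \<le> u s" "sum u S = 1" "x = (\<Sum>t\<in>S. u t *\<^sub>R t)"
  shows "real (card {s\<in>S. 0 < u s}) + real (card X) - 1 \<le> normalized_volume S"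
proof (rule normalized_volume_ge_support_aux[OF S(1,2,4) X(1,3,4) u])
  fix s assume s: "s \<in> S" "0 < u s"
  have xS: "x \<in> lattice" "x \<notin> S" using X by auto
  show "1 + real (card ((X - {x}) \<inter> convex hull (insert x (S - {s})))) \<le> normalized_volume (insert x (S - {s}))"
    by (rule normalized_volume_ge[OF normalized_volume_piece[OF S xS s(1) u(2,3) s(2)]]) (use X in auto)
qed auto

section \<open>Complete simplicial fans\<close>

definition pos_cone :: "'a::real_vector set \<Rightarrow> 'a set"
  where "pos_cone S = {\<Sum>u\<in>S. c u *\<^sub>R u | c. \<forall>u\<in>S. 0 \<le> c u}"

lemma pos_coneI: "(\<And>u. u \<in> S \<Longrightarrow> 0 \<le> c u) \<Longrightarrow> x = (\<Sum>u\<in>S. c u *\<^sub>R u) \<Longrightarrow> x \<in> pos_cone S"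
  unfolding pos_cone_def by blast

lemma pos_coneE:
  assumes "x \<in> pos_cone S"
  obtains c where "\<And>u. u \<in> S \<Longrightarrow> 0 \<le> c u" "x = (\<Sum>u\<in>S. c u *\<^sub>R u)"
  using assms unfolding pos_cone_def by blast

lemma pos_cone_subset_span: "pos_cone S \<subseteq> span S"
proof
  fix x assume "x \<in> pos_cone S"
  then obtain c where "x = (\<Sum>u\<in>S. c u *\<^sub>R u)" by (elim pos_coneE)
  then show "x \<in> span S" by (auto intro: span_sum span_scale span_base)
qed

lemma pos_cone_empty [simp]: "pos_cone {} = {0}"
  by (auto simp: pos_cone_def)

lemma sum_mem_pos_cone:
  assumes "finite S" "F \<subseteq> S"
  shows "\<Sum>F \<in> pos_cone S"
proof (rule pos_coneI[where c = "\<lambda>u. if u \<in> F then 1 else 0"])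
  have "\<Sum>F = (\<Sum>u\<in>F. (if u \<in> F then 1 else 0 :: real) *\<^sub>R u)"
    by simp
  also have "\<dots> = (\<Sum>u\<in>S. (if u \<in> F then 1 else 0 :: real) *\<^sub>R u)"
    using assms by (intro sum.mono_neutral_left) auto
  finally show "\<Sum>F = (\<Sum>u\<in>S. (if u \<in> F then 1 else 0 :: real) *\<^sub>R u)" .
qed auto

text \<open>The extended linear functional is represented by a vector, so that dual bases,
  supporting hyperplanes and points of the polar polytope are all handled by inner products.\<close>

lemma independent_functional_exists:
  fixes S :: "'a::euclidean_space set"
  assumes "independent S"
  obtains a where "\<And>u. u \<in> S \<Longrightarrow> a \<bullet> u = g u"
proof -
  obtain f :: "'a \<Rightarrow> real" where f: "linear f" "\<And>u. u \<in> S \<Longrightarrow> f u = g u"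
    using linear_independent_extend[OF assms, of g] by blast
  have "f x = (\<Sum>b\<in>Basis. f b *\<^sub>R b) \<bullet> x" for x
  proof -
    have "f x = f (\<Sum>b\<in>Basis. (x \<bullet> b) *\<^sub>R b)" by (simp add: euclidean_representation)
    also have "\<dots> = (\<Sum>b\<in>Basis. (x \<bullet> b) * f b)"
      by (simp add: linear_sum[OF f(1)] linear_cmul[OF f(1)])
    also have "\<dots> = (\<Sum>b\<in>Basis. f b *\<^sub>R b) \<bullet> x"
      by (simp add: inner_sum_left inner_commute[of x] mult.commute)
    finally show ?thesis .
  qed
  then show thesis using f(2) that by metis
qed

lemma independent_coordinate_exists:
  fixes S :: "'a::euclidean_space set"
  assumes "independent S" "v \<in> S"
  obtains a where "\<And>c. a \<bullet> (\<Sum>u\<in>S. c u *\<^sub>R u) = c v"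
proof -
  obtain a where a: "\<And>u. u \<in> S \<Longrightarrow> a \<bullet> u = (if u = v then 1 else 0)"
    using independent_functional_exists[OF assms(1), of "\<lambda>u. if u = v then 1 else 0"] by metis
  have "a \<bullet> (\<Sum>u\<in>S. c u *\<^sub>R u) = c v" for c
  proof -
    have "a \<bullet> (\<Sum>u\<in>S. c u *\<^sub>R u) = (\<Sum>u\<in>S. if u = v then c u else 0)"
      unfolding inner_sum_right by (intro sum.cong) (auto simp: a)
    also have "\<dots> = c v" using assms(2) independent_imp_finite[OF assms(1)] by simp
    finally show ?thesis .
  qed
  then show thesis by (rule that)
qed

lemma independent_coeff_unique:
  fixes S :: "'a::euclidean_space set"
  assumes "independent S" "(\<Sum>u\<in>S. c u *\<^sub>R u) = (\<Sum>u\<in>S. d u *\<^sub>R u)" "v \<in> S"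
  shows "c v = d v"
  using independent_coordinate_exists[OF assms(1,3)] assms(2) by metis

lemma basis_expansion:
  fixes S :: "'a::euclidean_space set"
  assumes "independent S" "card S = DIM('a)"
  obtains c where "y = (\<Sum>u\<in>S. c u *\<^sub>R u)"
proof -
  have "span S = UNIV"
    using assms card_ge_dim_independent[of S UNIV] by auto
  then have "y \<in> range (\<lambda>c. \<Sum>u\<in>S. c u *\<^sub>R u)"
    using span_finite[OF independent_imp_finite[OF assms(1)]] by auto
  then show thesis using that by blast
qed

text \<open>A full-dimensional simplicial cone is cut out by the half-spaces of the dual
  basis.\<close>

lemma closed_pos_cone:
  fixes S :: "'a::euclidean_space set"
  assumes "independent S" "card S = DIM('a)"
  shows "closed (pos_cone S)"
proof -
  have "\<exists>a. \<forall>c. a \<bullet> (\<Sum>u\<in>S. c u *\<^sub>R u) = c v" if "v \<in> S" for v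
    using independent_coordinate_exists[OF assms(1) that] by metis
  then obtain a where coord: "\<And>v c. v \<in> S \<Longrightarrow> a v \<bullet> (\<Sum>u\<in>S. c u *\<^sub>R u) = c v" by metis
  have "pos_cone S = (\<Inter>v\<in>S. {y. 0 \<le> a v \<bullet> y})"
  proof (intro equalityI subsetI)
    fix y assume "y \<in> (\<Inter>v\<in>S. {y. 0 \<le> a v \<bullet> y})"
    moreover obtain c where c: "y = (\<Sum>u\<in>S. c u *\<^sub>R u)" using basis_expansion[OF assms] .
    ultimately have "\<And>v. v \<in> S \<Longrightarrow> 0 \<le> c v" using coord by fastforce
    then show "y \<in> pos_cone S" using c by (rule pos_coneI)
  qed (auto elim!: pos_coneE simp: coord)
  then show ?thesis by (simp add: closed_INT closed_halfspace_ge)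
qed

lemma dependent_imp_dim_less_card:
  fixes A :: "'a::euclidean_space set"
  assumes "finite A" "dependent A"
  shows "dim A < card A"
proof -
  obtain a where a: "a \<in> A" "a \<in> span (A - {a})" using assms(2) unfolding dependent_def by blast
  have "dim A = dim (insert a (A - {a}))" using a(1) by (simp add: insert_absorb)
  also have "\<dots> = dim (A - {a})" using a(2) by (simp only: dim_insert if_True)
  also have "\<dots> \<le> card (A - {a})" using assms by (simp add: dim_le_card')
  also have "\<dots> < card A" using a assms by (meson card_Diff1_less)
  finally show ?thesis .
qed

text \<open>For independent \<open>A\<close> some \<open>y\<close> has product -1 with all of
  \<open>A\<close>, and it lies outside \<open>span F\<close>, which is orthogonal to
  \<open>A\<close>. For dependent \<open>A\<close> the orthogonal complement of \<open>A\<close> has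
  dimension larger than \<open>card F\<close>, so it contains a \<open>y\<close> outside
  \<open>span F\<close>.\<close>

lemma exists_nonpositive_direction:
  fixes A F :: "'a::euclidean_space set"
  assumes "finite A" "A \<noteq> {}" "finite F" "card A + card F \<le> DIM('a)"
    and orth: "\<And>a f. a \<in> A \<Longrightarrow> f \<in> F \<Longrightarrow> a \<bullet> f = 0"
  obtains y where "y \<notin> span F" "\<And>a. a \<in> A \<Longrightarrow> a \<bullet> y \<le> 0"
proof (cases "independent A")
  case True
  obtain y where y: "\<And>a. a \<in> A \<Longrightarrow> y \<bullet> a = -1"
    using independent_functional_exists[OF True, of "\<lambda>_. -1"] by metis
  obtain a where a: "a \<in> A" using assms by blast
  have "span F \<subseteq> {x. a \<bullet> x = 0}"
    using orth[OF a] by (intro span_minimal subspace_hyperplane) auto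
  then have "y \<notin> span F" using y[OF a] by (auto simp: inner_commute)
  then show thesis using that y by (metis inner_commute less_eq_real_def neg_less_0_iff_less zero_less_one)
next
  case False
  define B where "B = {y. \<forall>x\<in>span A. orthogonal x y}"
  have "dim B + dim (span A) = DIM('a)"
    using dim_subspace_orthogonal_to_vectors[of "span A" UNIV] by (simp add: B_def)
  moreover have "dim (span A) < card A" using False assms dependent_imp_dim_less_card by simp
  ultimately have "card F < dim B" using assms(4) by linarith
  moreover have "dim B \<le> card F" if "B \<subseteq> span F"
    using dim_subset[OF that] dim_le_card'[OF assms(3)] by simp
  ultimately obtain y where y: "y \<in> B" "y \<notin> span F" by fastforce
  have "a \<bullet> y \<le> 0" if "a \<in> A" for a
    using y that by (auto simp: B_def orthogonal_def span_base)
  then show thesis using that y by blast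
qed

text \<open>Only the maximal cones are listed, each by its set of generators. As the reverse
  inclusion is automatic, \<open>meet\<close> makes two cones intersect exactly in the cone over
  their common generators, a face of both.\<close>

locale simplicial_fan =
  fixes T :: "'a::euclidean_space set set"
  assumes finite_fan: "finite T"
    and independent_cell: "\<sigma> \<in> T \<Longrightarrow> independent \<sigma>"
    and card_cell: "\<sigma> \<in> T \<Longrightarrow> card \<sigma> = DIM('a)"
    and cover: "(\<Union>\<sigma>\<in>T. pos_cone \<sigma>) = UNIV"
    and meet: "\<sigma> \<in> T \<Longrightarrow> \<tau> \<in> T \<Longrightarrow> pos_cone \<sigma> \<inter> pos_cone \<tau> \<subseteq> pos_cone (\<sigma> \<inter> \<tau>)"
begin

lemma finite_cell: "\<sigma> \<in> T \<Longrightarrow> finite \<sigma>"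
  using independent_cell independent_imp_finite by blast

lemma finite_rays: "finite (\<Union>T)"
  using finite_fan finite_cell by blast

text \<open>\<open>\<Sum>F\<close> is a relative interior point of the cone over \<open>F\<close>:
  in the basis \<sigma> its coefficients on \<open>F\<close> are all 1, while \<open>meet\<close>
  rewrites it with generators that also lie in \<tau>.\<close>

lemma sum_face_mem_pos_cone:
  assumes \<sigma>: "\<sigma> \<in> T" "F \<subseteq> \<sigma>" and \<tau>: "\<tau> \<in> T" "\<Sum>F \<in> pos_cone \<tau>"
  shows "F \<subseteq> \<tau>"
proof
  fix v assume v: "v \<in> F"
  have "\<Sum>F \<in> pos_cone (\<sigma> \<inter> \<tau>)"
    using meet[OF \<sigma>(1) \<tau>(1)] \<tau>(2) sum_mem_pos_cone[OF finite_cell[OF \<sigma>(1)] \<sigma>(2)] by blast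
  then obtain c where c: "\<Sum>F = (\<Sum>u\<in>\<sigma> \<inter> \<tau>. c u *\<^sub>R u)" by (elim pos_coneE)
  have fin: "finite \<sigma>" by (rule finite_cell[OF \<sigma>(1)])
  have "(\<Sum>u\<in>\<sigma>. (if u \<in> F then 1 else 0) *\<^sub>R u) = (\<Sum>u\<in>F. (if u \<in> F then 1 else 0 :: real) *\<^sub>R u)"
    using fin \<sigma>(2) by (intro sum.mono_neutral_right) auto
  also have "\<dots> = \<Sum>F" by simp
  also have "\<dots> = (\<Sum>u\<in>\<sigma> \<inter> \<tau>. (if u \<in> \<tau> then c u else 0) *\<^sub>R u)" unfolding c by simp
  also have "\<dots> = (\<Sum>u\<in>\<sigma>. (if u \<in> \<tau> then c u else 0) *\<^sub>R u)"
    using fin by (intro sum.mono_neutral_left) auto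
  finally have "(if v \<in> F then 1 else 0) = (if v \<in> \<tau> then c v else 0)"
    by (rule independent_coeff_unique[OF independent_cell[OF \<sigma>(1)]]) (use v \<sigma> in auto)
  then show "v \<in> \<tau>" using v by (auto split: if_splits)
qed

text \<open>
  The cones containing a face \<open>F\<close> cover a neighbourhood of a relative interior point of \<open>F\<close>, hence the
  whole quotient space by \<open>span F\<close>. Each of them lies strictly on one side of a hyperplane of that
  quotient, and \<open>d\<close> open half spaces never cover a punctured space of dimension \<open>d\<close>.
\<close>

lemma card_star_ge:
  assumes \<sigma>0: "\<sigma>0 \<in> T" "F \<subseteq> \<sigma>0"
  shows "DIM('a) + 1 \<le> card {\<sigma>\<in>T. F \<subseteq> \<sigma>} + card F"
proof (rule ccontr)
  define St where "St = {\<sigma>\<in>T. F \<subseteq> \<sigma>}"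
  assume "\<not> ?thesis"
  then have le: "card St + card F \<le> DIM('a)" by (simp add: St_def)
  have finF: "finite F" using \<sigma>0 finite_cell finite_subset by blast
  have finSt: "finite St" using finite_fan by (simp add: St_def)
  \<comment> \<open>On the cone of \<sigma> this functional is nonnegative and vanishes only on the
    face over \<open>F\<close>.\<close>
  have "\<exists>a. \<forall>u\<in>\<sigma>. a \<bullet> u = (if u \<in> F then 0 else 1)" if "\<sigma> \<in> St" for \<sigma>
    using independent_functional_exists[OF independent_cell, of \<sigma> "\<lambda>u. if u \<in> F then 0 else 1"] that
    by (metis (no_types, lifting) St_def mem_Collect_eq)
  then obtain a where a: "\<And>\<sigma> u. \<sigma> \<in> St \<Longrightarrow> u \<in> \<sigma> \<Longrightarrow> a \<sigma> \<bullet> u = (if u \<in> F then 0 else 1)"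
    by metis
  have aF: "a \<sigma> \<bullet> f = 0" if "\<sigma> \<in> St" "f \<in> F" for \<sigma> f
    using a[OF that(1)] that by (auto simp: St_def)
  have "card (a ` St) + card F \<le> DIM('a)" using le card_image_le[OF finSt, of a] by linarith
  moreover have "a ` St \<noteq> {}" using \<sigma>0 by (auto simp: St_def)
  moreover have "b \<bullet> f = 0" if "b \<in> a ` St" "f \<in> F" for b f using that aF by auto
  ultimately obtain y where y: "y \<notin> span F" "\<And>b. b \<in> a ` St \<Longrightarrow> b \<bullet> y \<le> 0"
    using exists_nonpositive_direction[OF finite_imageI[OF finSt] _ finF] by metis
  define w where "w = \<Sum>F"
  \<comment> \<open>The cones outside the star form a closed set that misses the relative interior
    point \<open>w\<close> of the face, so a short move from \<open>w\<close> along \<open>y\<close>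
    ends in a cone of the star.\<close>
  define K where "K = (\<Union>\<sigma>\<in>T - St. pos_cone \<sigma>)"
  have "closed K"
    unfolding K_def using finite_fan closed_pos_cone independent_cell card_cell by (intro closed_UN) auto
  moreover have "w \<notin> K"
    using sum_face_mem_pos_cone[OF \<sigma>0] by (auto simp: K_def w_def St_def)
  moreover have "((\<lambda>\<epsilon>. w + \<epsilon> *\<^sub>R y) \<longlongrightarrow> w + 0 *\<^sub>R y) (at_right 0)"
    by (intro tendsto_intros)
  ultimately have "\<forall>\<^sub>F \<epsilon> in at_right (0::real). w + \<epsilon> *\<^sub>R y \<in> - K"
    using topological_tendstoD[of "\<lambda>\<epsilon>::real. w + \<epsilon> *\<^sub>R y" w "at_right 0" "- K"] by (simp add: open_Compl)
  then have "\<forall>\<^sub>F \<epsilon> in at_right (0::real). 0 < \<epsilon> \<and> w + \<epsilon> *\<^sub>R y \<notin> K"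
    using eventually_at_right_less by eventually_elim simp
  then obtain \<epsilon> :: real where \<epsilon>: "0 < \<epsilon>" "w + \<epsilon> *\<^sub>R y \<notin> K"
    using eventually_happens'[OF trivial_limit_at_right_real] by blast
  have "w + \<epsilon> *\<^sub>R y \<in> (\<Union>\<sigma>\<in>T. pos_cone \<sigma>)" unfolding cover by (rule UNIV_I)
  then obtain \<sigma> where \<sigma>: "\<sigma> \<in> St" "w + \<epsilon> *\<^sub>R y \<in> pos_cone \<sigma>"
    using \<epsilon>(2) unfolding K_def by blast
  then obtain c where c: "\<And>u. u \<in> \<sigma> \<Longrightarrow> 0 \<le> c u" "w + \<epsilon> *\<^sub>R y = (\<Sum>u\<in>\<sigma>. c u *\<^sub>R u)"
    by - (rule pos_coneE[OF \<sigma>(2)], rule that)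
  have fin: "finite \<sigma>" and F: "F \<subseteq> \<sigma>" using \<sigma> finite_cell by (auto simp: St_def)
  \<comment> \<open>A nonpositive value of \<open>a \<sigma>\<close> at a point of the cone forces
    all coefficients outside \<open>F\<close> to vanish, which puts \<open>y\<close> into
    \<open>span F\<close>.\<close>
  have "a \<sigma> \<bullet> w = 0" using aF[OF \<sigma>(1)] by (simp add: w_def inner_sum_right)
  then have "a \<sigma> \<bullet> (\<Sum>u\<in>\<sigma>. c u *\<^sub>R u) = \<epsilon> * (a \<sigma> \<bullet> y)"
    unfolding c(2)[symmetric] by (simp add: inner_add_right)
  moreover have "\<epsilon> * (a \<sigma> \<bullet> y) \<le> 0" using \<epsilon> y(2)[OF imageI[OF \<sigma>(1)]] by (simp add: mult_nonneg_nonpos)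
  moreover have "a \<sigma> \<bullet> (\<Sum>u\<in>\<sigma>. c u *\<^sub>R u) = (\<Sum>u\<in>\<sigma> - F. c u)"
    unfolding inner_sum_right using fin
    by (intro sum.mono_neutral_cong_right) (auto simp: a[OF \<sigma>(1)])
  ultimately have "(\<Sum>u\<in>\<sigma> - F. c u) \<le> 0" by simp
  then have "(\<Sum>u\<in>\<sigma> - F. c u) = 0" using c(1) by (intro antisym sum_nonneg) auto
  then have c0: "c u = 0" if "u \<in> \<sigma> - F" for u
    using that c(1) fin by (subst (asm) sum_nonneg_eq_0_iff) auto
  have "(\<Sum>u\<in>\<sigma>. c u *\<^sub>R u) = (\<Sum>u\<in>F. c u *\<^sub>R u)"
    using fin F c0 by (intro sum.mono_neutral_right) auto
  then have "w + \<epsilon> *\<^sub>R y \<in> span F" unfolding c(2) by (auto intro: span_sum span_scale span_base)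
  moreover have "w \<in> span F" unfolding w_def by (intro span_sum span_base)
  ultimately have "\<epsilon> *\<^sub>R y \<in> span F" using span_diff by fastforce
  then have "(1 / \<epsilon>) *\<^sub>R \<epsilon> *\<^sub>R y \<in> span F" by (rule span_scale)
  then show False using \<epsilon> y(1) by simp
qed

text \<open>Double counting of the pairs of a cell and one of its rays. A general \<open>T'\<close>
  allows the count in all of \<open>T\<close> as well as in the star of one ray.\<close>

lemma sum_card_cells:
  assumes "T' \<subseteq> T" "finite W" "\<Union>T' \<subseteq> W"
  shows "(\<Sum>w\<in>W. card {\<sigma>\<in>T'. w \<in> \<sigma>}) = DIM('a) * card T'"
proof -
  have fin: "finite T'" using assms finite_fan finite_subset by blast
  have "(\<Sum>w\<in>W. card {\<sigma>\<in>T'. w \<in> \<sigma>}) = (\<Sum>w\<in>W. \<Sum>\<sigma> | \<sigma> \<in> T' \<and> w \<in> \<sigma>. 1)" by simp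
  also have "\<dots> = (\<Sum>\<sigma>\<in>T'. \<Sum>w | w \<in> W \<and> w \<in> \<sigma>. 1)"
    using fin assms by (intro sum.swap_restrict) auto
  also have "\<dots> = (\<Sum>\<sigma>\<in>T'. DIM('a))"
  proof (rule sum.cong)
    fix \<sigma> assume "\<sigma> \<in> T'"
    then have "{w. w \<in> W \<and> w \<in> \<sigma>} = \<sigma>" "\<sigma> \<in> T" using assms by auto
    then show "(\<Sum>w | w \<in> W \<and> w \<in> \<sigma>. 1) = DIM('a)" using card_cell by simp
  qed simp
  finally show ?thesis by simp
qed

lemma card_ray_star_ge:
  assumes "w \<in> \<Union>T"
  shows "DIM('a) \<le> card {\<sigma>\<in>T. w \<in> \<sigma>}"
proof -
  obtain \<sigma> where "\<sigma> \<in> T" "w \<in> \<sigma>" using assms by blast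
  then show ?thesis using card_star_ge[of \<sigma> "{w}"] by simp
qed

lemma card_rays_le: "card (\<Union>T) \<le> card T"
proof -
  have "DIM('a) * card (\<Union>T) = (\<Sum>w\<in>\<Union>T. DIM('a))" by simp
  also have "\<dots> \<le> (\<Sum>w\<in>\<Union>T. card {\<sigma>\<in>T. w \<in> \<sigma>})"
    by (intro sum_mono card_ray_star_ge)
  also have "\<dots> = DIM('a) * card T" using finite_rays by (intro sum_card_cells) auto
  finally show ?thesis by simp
qed

text \<open>
  If there are as few cones as rays, every ray lies in exactly \<open>n\<close> of them; as \<open>n \<ge> 3\<close>, the count
  above in the link of the ray shows that these \<open>n\<close> cones have only \<open>n\<close> further rays.
\<close>

lemma star_of_ray_tight:
  assumes dim: "3 \<le> DIM('a)" and eq: "card (\<Union>T) = card T" and w: "w \<in> \<Union>T"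
  obtains Z where "finite Z" "card Z = DIM('a) + 1" "w \<in> Z"
    "\<And>\<sigma>. w \<in> \<sigma> \<Longrightarrow> \<sigma> \<in> T \<longleftrightarrow> \<sigma> \<subseteq> Z \<and> card \<sigma> = DIM('a)"
proof -
  let ?n = "DIM('a)"
  define S where "S = {\<sigma>\<in>T. w \<in> \<sigma>}"
  define N where "N = \<Union>S - {w}"
  have finS: "finite S" using finite_fan by (simp add: S_def)
  have finN: "finite N" using finS finite_cell by (auto simp: N_def S_def)
  have cardS: "card S = ?n"
  proof (rule ccontr)
    assume "card S \<noteq> ?n"
    then have "?n < card {\<sigma>\<in>T. w \<in> \<sigma>}" using card_ray_star_ge[OF w] by (simp add: S_def)
    then have "(\<Sum>w\<in>\<Union>T. ?n) < (\<Sum>w\<in>\<Union>T. card {\<sigma>\<in>T. w \<in> \<sigma>})"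
      using w card_ray_star_ge finite_rays by (intro sum_strict_mono_ex1) auto
    also have "\<dots> = ?n * card T" using finite_rays by (intro sum_card_cells) auto
    finally show False using eq by simp
  qed
  \<comment> \<open>The star bound for the face with generators \<open>w\<close> and
    \<open>u\<close>: all cones through it lie in \<open>S\<close>.\<close>
  have deg: "?n - 1 \<le> card {\<sigma>\<in>S. u \<in> \<sigma>}" if "u \<in> N" for u
  proof -
    obtain \<sigma> where "\<sigma> \<in> S" "u \<in> \<sigma>" and uw: "u \<noteq> w" using \<open>u \<in> N\<close> unfolding N_def by blast
    then have \<sigma>: "\<sigma> \<in> T" "{w, u} \<subseteq> \<sigma>" by (auto simp: S_def)
    have "{\<sigma>\<in>S. u \<in> \<sigma>} = {\<sigma>\<in>T. {w, u} \<subseteq> \<sigma>}" by (auto simp: S_def)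
    then show ?thesis using card_star_ge[OF \<sigma>] uw by simp
  qed
  have "card {\<sigma>\<in>S. w \<in> \<sigma>} + (\<Sum>u\<in>N. card {\<sigma>\<in>S. u \<in> \<sigma>}) = (\<Sum>u\<in>insert w N. card {\<sigma>\<in>S. u \<in> \<sigma>})"
    using finN by (subst sum.insert) (auto simp: N_def)
  also have "\<dots> = ?n * card S" using finN by (intro sum_card_cells) (auto simp: N_def S_def)
  also have "{\<sigma>\<in>S. w \<in> \<sigma>} = S" by (auto simp: S_def)
  finally have "(\<Sum>u\<in>N. card {\<sigma>\<in>S. u \<in> \<sigma>}) = (?n - 1) * ?n"
    using cardS by (simp add: diff_mult_distrib)
  moreover have "(\<Sum>u\<in>N. ?n - 1) \<le> (\<Sum>u\<in>N. card {\<sigma>\<in>S. u \<in> \<sigma>})" by (intro sum_mono deg)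
  ultimately have "(?n - 1) * card N \<le> (?n - 1) * ?n" by (simp add: mult.commute)
  then have N_le: "card N \<le> ?n" using dim by simp
  \<comment> \<open>Deleting \<open>w\<close> embeds the \<open>n\<close> cones of \<open>S\<close>
    into the \<open>(n - 1)\<close>-subsets of \<open>N\<close>. With fewer than \<open>n\<close>
    elements in \<open>N\<close> there would be at most one such subset. So \<open>N\<close> has
    \<open>n\<close> elements, there are exactly \<open>n\<close> subsets, and each of them
    occurs.\<close>
  define R where "R = {\<rho>. \<rho> \<subseteq> N \<and> card \<rho> = ?n - 1}"
  have finR: "finite R" using finN by (simp add: R_def)
  have cardR: "card R = card N choose (?n - 1)" using n_subsets[OF finN] by (simp add: R_def)
  have inj: "inj_on (\<lambda>\<sigma>. \<sigma> - {w}) S" by (auto simp: inj_on_def S_def)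
  have sub: "(\<lambda>\<sigma>. \<sigma> - {w}) ` S \<subseteq> R"
    using card_cell finite_cell by (auto simp: S_def R_def N_def)
  have cardSi: "card ((\<lambda>\<sigma>. \<sigma> - {w}) ` S) = ?n" using card_image[OF inj] cardS by simp
  then have n_le: "?n \<le> card N choose (?n - 1)" using card_mono[OF finR sub] cardR by simp
  have cardN: "card N = ?n"
  proof (rule ccontr)
    assume "card N \<noteq> ?n"
    then have "card N = ?n - 1 \<or> card N < ?n - 1" using N_le by linarith
    then have "card N choose (?n - 1) \<le> 1" by (auto simp: binomial_eq_0)
    then show False using n_le dim by simp
  qed
  have "card R = ?n" unfolding cardR cardN using dim by (cases ?n) auto
  then have R: "(\<lambda>\<sigma>. \<sigma> - {w}) ` S = R" using card_subset_eq[OF finR sub] cardSi by simp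
  have wN: "w \<notin> N" by (simp add: N_def)
  have "\<sigma> \<in> T \<longleftrightarrow> \<sigma> \<subseteq> insert w N \<and> card \<sigma> = ?n" if "w \<in> \<sigma>" for \<sigma>
  proof
    assume "\<sigma> \<in> T"
    then show "\<sigma> \<subseteq> insert w N \<and> card \<sigma> = ?n" using that card_cell by (auto simp: N_def S_def)
  next
    assume \<sigma>: "\<sigma> \<subseteq> insert w N \<and> card \<sigma> = ?n"
    then have "\<sigma> - {w} \<in> R"
      using that finN finite_subset[of \<sigma> "insert w N"] by (auto simp: R_def)
    then obtain \<tau> where "\<tau> \<in> S" "\<sigma> - {w} = \<tau> - {w}" using R by blast
    then have "\<sigma> = \<tau>" "\<tau> \<in> T" using that by (auto simp: S_def)
    then show "\<sigma> \<in> T" by simp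
  qed
  moreover have "card (insert w N) = ?n + 1" using finN wN cardN by simp
  ultimately show thesis using that[of "insert w N"] finN by blast
qed

text \<open>The star of a ray \<open>w\<close> consists of the \<open>n\<close>-subsets containing
  \<open>w\<close> of some set \<open>Z\<close> with \<open>n + 1\<close> elements. The set is the
  same for every ray in \<open>Z\<close>, and connectedness of the punctured space excludes cones
  away from \<open>Z\<close>.\<close>

lemma fan_tight:
  assumes dim: "3 \<le> DIM('a)" and eq: "card (\<Union>T) = card T"
  shows "card (\<Union>T) = DIM('a) + 1" "T = {\<sigma>. \<sigma> \<subseteq> \<Union>T \<and> card \<sigma> = DIM('a)}"
proof -
  let ?n = "DIM('a)"
  have "T \<noteq> {}" using cover by auto
  then obtain \<sigma>1 where \<sigma>1: "\<sigma>1 \<in> T" by blast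
  then obtain w where w: "w \<in> \<sigma>1" using card_cell dim by fastforce
  then have wT: "w \<in> \<Union>T" using \<sigma>1 by blast
  obtain Z where Z: "finite Z" "card Z = ?n + 1" "w \<in> Z"
    and Zw: "\<And>\<sigma>. w \<in> \<sigma> \<Longrightarrow> \<sigma> \<in> T \<longleftrightarrow> \<sigma> \<subseteq> Z \<and> card \<sigma> = ?n"
    by (rule star_of_ray_tight[OF dim eq wT]) (rule that)
  \<comment> \<open>Here \<open>n \<ge> 3\<close> enters: a single cone can contain
    \<open>u\<close>, \<open>v\<close> and \<open>w\<close>, so that \<open>v\<close> is seen from
    the star of \<open>u\<close>.\<close>
  have sub: "\<exists>\<sigma>. {u, v, w} \<subseteq> \<sigma> \<and> \<sigma> \<subseteq> Z \<and> card \<sigma> = ?n" if "u \<in> Z" "v \<in> Z" for u v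
  proof -
    have "card {u, v, w} \<le> 3" by (simp add: card_insert_if)
    then show ?thesis
      using exists_subset_between[of "{u, v, w}" ?n Z] that Z dim by auto
  qed
  have Zu: "\<sigma> \<in> T \<longleftrightarrow> \<sigma> \<subseteq> Z \<and> card \<sigma> = ?n" if "u \<in> Z" "u \<in> \<sigma>" for u \<sigma>
  proof -
    obtain \<rho> where "{u, u, w} \<subseteq> \<rho>" "\<rho> \<subseteq> Z" "card \<rho> = ?n" using sub[OF \<open>u \<in> Z\<close> \<open>u \<in> Z\<close>] by blast
    then have "u \<in> \<Union>T" using Zw[of \<rho>] by blast
    then obtain Z' where Z': "finite Z'" "card Z' = ?n + 1"
      and Zu': "\<And>\<sigma>. u \<in> \<sigma> \<Longrightarrow> \<sigma> \<in> T \<longleftrightarrow> \<sigma> \<subseteq> Z' \<and> card \<sigma> = ?n"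
      by (rule star_of_ray_tight[OF dim eq]) (rule that)
    have "Z \<subseteq> Z'"
    proof
      fix v assume v: "v \<in> Z"
      obtain \<tau> where "{u, v, w} \<subseteq> \<tau>" "\<tau> \<subseteq> Z" "card \<tau> = ?n" using sub[OF \<open>u \<in> Z\<close> v] by blast
      then show "v \<in> Z'" using Zw[of \<tau>] Zu'[of \<tau>] by blast
    qed
    then have "Z = Z'" using Z Z' by (metis card_subset_eq)
    then show ?thesis using Zu' that by blast
  qed
  \<comment> \<open>A cell that meets \<open>Z\<close> is contained in \<open>Z\<close>, so cells of
    the two kinds share no ray and their cones meet only in 0. Away from 0 they would split the
    space into two closed parts.\<close>
  define T1 where "T1 = {\<sigma>\<in>T. \<sigma> \<inter> Z \<noteq> {}}"
  define T2 where "T2 = {\<sigma>\<in>T. \<sigma> \<inter> Z = {}}"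
  define A where "A T' = (\<Union>\<sigma>\<in>T'. pos_cone \<sigma>)" for T' :: "'a set set"
  have closedA: "closed (A T')" if "T' \<subseteq> T" for T'
    unfolding A_def using that independent_cell card_cell finite_subset[OF that finite_fan]
    by (intro closed_UN ballI closed_pos_cone) auto
  have nonzero: "\<exists>u. u \<noteq> 0 \<and> u \<in> pos_cone \<sigma>" if "\<sigma> \<in> T" for \<sigma>
  proof -
    have "\<sigma> \<noteq> {}" using card_cell[OF that] by auto
    then obtain u where "u \<in> \<sigma>" by blast
    moreover have "u \<noteq> 0" using independent_cell[OF that] \<open>u \<in> \<sigma>\<close> dependent_zero by blast
    moreover have "u \<in> pos_cone \<sigma>"
      using sum_mem_pos_cone[OF finite_cell[OF that], of "{u}"] \<open>u \<in> \<sigma>\<close> by simp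
    ultimately show ?thesis by blast
  qed
  have "T2 = {}"
  proof (rule ccontr)
    assume "T2 \<noteq> {}"
    have sub12: "T1 \<subseteq> T" "T2 \<subseteq> T" by (auto simp: T1_def T2_def)
    have ne: "A T' \<inter> - {0} \<noteq> {}" if "\<sigma> \<in> T'" "T' \<subseteq> T" for \<sigma> T'
      using nonzero[of \<sigma>] that unfolding A_def by blast
    have \<sigma>1T: "\<sigma>1 \<in> T1" using \<sigma>1 w Z by (auto simp: T1_def)
    obtain \<sigma>2 where \<sigma>2: "\<sigma>2 \<in> T2" using \<open>T2 \<noteq> {}\<close> by blast
    have "A T1 \<inter> A T2 \<subseteq> {0}"
    proof
      fix x assume "x \<in> A T1 \<inter> A T2"
      then obtain \<sigma> \<tau> where st: "\<sigma> \<in> T1" "\<tau> \<in> T2" "x \<in> pos_cone \<sigma>" "x \<in> pos_cone \<tau>"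
        by (auto simp: A_def)
      then obtain z where z: "z \<in> Z" "z \<in> \<sigma>" "\<sigma> \<in> T" by (auto simp: T1_def)
      then have "\<sigma> \<subseteq> Z" using Zu by blast
      then have "\<sigma> \<inter> \<tau> = {}" using st by (auto simp: T2_def)
      then show "x \<in> {0}" using meet[of \<sigma> \<tau>] st sub12 by auto
    qed
    moreover have "- {0} \<subseteq> A T1 \<union> A T2"
    proof -
      have "T1 \<union> T2 = T" by (auto simp: T1_def T2_def)
      then have "A T1 \<union> A T2 = UNIV" unfolding A_def cover[symmetric] by blast
      then show ?thesis by simp
    qed
    moreover have "A T1 \<inter> - {0} \<noteq> {}" "A T2 \<inter> - {0} \<noteq> {}"
      using ne[OF \<sigma>1T sub12(1)] ne[OF \<sigma>2 sub12(2)] by auto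
    moreover have "connected (- {0 :: 'a})"
      using dim by (intro connected_punctured_universe) simp
    moreover have "closed (A T1)" "closed (A T2)" using closedA sub12 by auto
    ultimately show False unfolding connected_closed by blast
  qed
  then have T: "T = {\<sigma>. \<sigma> \<subseteq> Z \<and> card \<sigma> = ?n}"
  proof (intro equalityI subsetI)
    fix \<sigma> assume "\<sigma> \<in> {\<sigma>. \<sigma> \<subseteq> Z \<and> card \<sigma> = ?n}"
    moreover then have "\<sigma> \<noteq> {}" using dim by auto
    ultimately show "\<sigma> \<in> T" using Zu by blast
  next
    fix \<sigma> assume "\<sigma> \<in> T"
    with \<open>T2 = {}\<close> obtain z where "z \<in> \<sigma>" "z \<in> Z" by (auto simp: T2_def)
    then show "\<sigma> \<in> {\<sigma>. \<sigma> \<subseteq> Z \<and> card \<sigma> = ?n}" using Zu \<open>\<sigma> \<in> T\<close> by blast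
  qed
  have "\<Union>T = Z" using sub unfolding T by blast
  then show "card (\<Union>T) = ?n + 1" "T = {\<sigma>. \<sigma> \<subseteq> \<Union>T \<and> card \<sigma> = ?n}" using Z T by auto
qed

end

section \<open>Triangulating the boundary of a polytope\<close>

text \<open>For a basis \<sigma> and a further point \<open>v\<close>, tightness of \<open>v\<close>
  at the functional fitting the heights on \<sigma> is a polynomial equation in \<open>t\<close>.
  The heights \<open>1 + t ^ Suc (i v)\<close> have distinct exponents, so the polynomial is nonzero
  and has no roots at small \<open>t > 0\<close>. Its value at 0 is
  \<open>g \<bullet> v - 1\<close>; if this is positive, \<open>v\<close> violates the perturbed
  constraint as well, whence the last claim.\<close>

lemma generic_heights_exist:
  fixes V :: "'a::euclidean_space set"
  assumes V: "finite V"
  obtains h :: "'a \<Rightarrow> real" where "\<And>v. v \<in> V \<Longrightarrow> 0 < h v"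
    "\<And>\<sigma> v f. \<sigma> \<subseteq> V \<Longrightarrow> independent \<sigma> \<Longrightarrow> card \<sigma> = DIM('a) \<Longrightarrow> v \<in> V - \<sigma> \<Longrightarrow> (\<And>u. u \<in> \<sigma> \<Longrightarrow> f \<bullet> u = h u) \<Longrightarrow> f \<bullet> v \<noteq> h v"
    "\<And>\<sigma> v f g. \<sigma> \<subseteq> V \<Longrightarrow> independent \<sigma> \<Longrightarrow> card \<sigma> = DIM('a) \<Longrightarrow> v \<in> V - \<sigma> \<Longrightarrow> (\<And>u. u \<in> \<sigma> \<Longrightarrow> f \<bullet> u = h u) \<Longrightarrow>
      f \<bullet> v \<le> h v \<Longrightarrow> (\<And>u. u \<in> \<sigma> \<Longrightarrow> g \<bullet> u = 1) \<Longrightarrow> g \<bullet> v \<le> 1"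
proof -
  obtain i :: "'a \<Rightarrow> nat" where i: "inj_on i V"
    using finite_imp_inj_to_nat_seg[OF V] by blast
  define h where "h t v = 1 + t ^ Suc (i v)" for t :: real and v
  define E where "E = {(\<sigma>, v). \<sigma> \<subseteq> V \<and> independent \<sigma> \<and> card \<sigma> = DIM('a) \<and> v \<in> V - \<sigma>}"
  have "E \<subseteq> Pow V \<times> V" by (auto simp: E_def)
  then have finE: "finite E" using V finite_subset by blast
  define good where "good t e \<longleftrightarrow> (case e of (\<sigma>, v) \<Rightarrow> \<forall>f. (\<forall>u\<in>\<sigma>. f \<bullet> u = h t u) \<longrightarrow>
    f \<bullet> v \<noteq> h t v \<and> (f \<bullet> v \<le> h t v \<longrightarrow> (\<forall>g. (\<forall>u\<in>\<sigma>. g \<bullet> u = 1) \<longrightarrow> g \<bullet> v \<le> 1)))" for t e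
  have "\<forall>\<^sub>F t in at_right (0::real). good t e" if e: "e \<in> E" for e
  proof -
    obtain \<sigma> v where e': "e = (\<sigma>, v)" by (cases e)
    then have \<sigma>: "\<sigma> \<subseteq> V" "independent \<sigma>" "card \<sigma> = DIM('a)" "v \<in> V" "v \<notin> \<sigma>" using e by (auto simp: E_def)
    obtain a where a: "v = (\<Sum>u\<in>\<sigma>. a u *\<^sub>R u)" using basis_expansion[OF \<sigma>(2,3)] .
    have fin: "finite \<sigma>" using \<sigma> V finite_subset by blast
    have val: "f \<bullet> v = (\<Sum>u\<in>\<sigma>. a u * k u)" if "\<forall>u\<in>\<sigma>. f \<bullet> u = k u" for f k
      unfolding a inner_sum_right using that by (intro sum.cong) auto
    \<comment> \<open>The value at \<open>t\<close> is \<open>f \<bullet> v - h t v\<close>. The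
      coefficient at the exponent of \<open>v\<close> is -1, because no point of \<sigma> shares
      this exponent.\<close>
    define p where "p = (\<Sum>u\<in>\<sigma>. smult (a u) (1 + monom 1 (Suc (i u)))) - (1 + monom 1 (Suc (i v)))"
    have p: "poly p t = (\<Sum>u\<in>\<sigma>. a u * h t u) - h t v" for t
      by (simp add: p_def h_def poly_sum poly_monom)
    have "coeff p (Suc (i v)) = (\<Sum>u\<in>\<sigma>. a u * (if i u = i v then 1 else 0)) - 1"
      by (simp add: p_def coeff_sum)
    also have "(\<Sum>u\<in>\<sigma>. a u * (if i u = i v then 1 else 0)) = 0"
    proof (rule sum.neutral, rule ballI)
      fix u assume "u \<in> \<sigma>"
      then have "i u \<noteq> i v" using i \<sigma> by (auto simp: inj_on_def)
      then show "a u * (if i u = i v then 1 else 0) = 0" by simp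
    qed
    finally have "p \<noteq> 0" by auto
    then have "finite {t. poly p t = 0}" by (rule poly_roots_finite)
    then have "\<not> 0 islimpt {t. poly p t = 0}" by (rule islimpt_finite)
    then have "\<forall>\<^sub>F t in at 0. t \<notin> {t. poly p t = 0}" by (simp add: islimpt_iff_eventually)
    then have nz: "\<forall>\<^sub>F t in at_right 0. poly p t \<noteq> 0"
      using filter_leD[OF at_le[OF subset_UNIV]] by simp
    have "\<forall>\<^sub>F t in at_right 0. 0 < poly p t" if "(\<Sum>u\<in>\<sigma>. a u) > 1"
    proof -
      have "poly p 0 > 0" using that by (simp add: p h_def)
      moreover have "(poly p \<longlongrightarrow> poly p 0) (at_right 0)" by (intro tendsto_intros)
      ultimately show ?thesis by (rule order_tendstoD(1)[rotated])
    qed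
    then have "\<forall>\<^sub>F t in at_right 0. (\<Sum>u\<in>\<sigma>. a u) > 1 \<longrightarrow> 0 < poly p t"
      by (cases "(\<Sum>u\<in>\<sigma>. a u) > 1") auto
    with nz show ?thesis
    proof eventually_elim
      case (elim t)
      then show ?case
        unfolding good_def e' using val[of _ "h t"] val[of _ "\<lambda>_. 1"] p[of t] by (auto simp: not_le)
    qed
  qed
  then have "\<forall>\<^sub>F t in at_right (0::real). \<forall>e\<in>E. good t e"
    using finE by (simp add: eventually_ball_finite)
  then have "\<forall>\<^sub>F t in at_right (0::real). 0 < t \<and> (\<forall>e\<in>E. good t e)"
    using eventually_at_right_less by eventually_elim simp
  then obtain t :: real where t: "0 < t" "\<And>e. e \<in> E \<Longrightarrow> good t e"
    using eventually_happens'[OF trivial_limit_at_right_real] by blast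
  show thesis
  proof (rule that[of "h t"])
    show "0 < h t v" for v using t(1) by (simp add: h_def add_pos_pos)
    fix \<sigma> v f assume "\<sigma> \<subseteq> V" "independent \<sigma>" "card \<sigma> = DIM('a)" "v \<in> V - \<sigma>"
      and f: "\<And>u. u \<in> \<sigma> \<Longrightarrow> f \<bullet> u = h t u"
    then have "good t (\<sigma>, v)" by (intro t(2)) (auto simp: E_def)
    then have good: "f \<bullet> v \<noteq> h t v \<and> (f \<bullet> v \<le> h t v \<longrightarrow> (\<forall>g. (\<forall>u\<in>\<sigma>. g \<bullet> u = 1) \<longrightarrow> g \<bullet> v \<le> 1))"
      using f unfolding good_def by blast
    then show "f \<bullet> v \<noteq> h t v" by blast
    show "g \<bullet> v \<le> 1" if "f \<bullet> v \<le> h t v" "\<And>u. u \<in> \<sigma> \<Longrightarrow> g \<bullet> u = 1" for g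
      using good that by blast
  qed
qed

text \<open>
  The fan over the boundary of \<open>conv V\<close>, with the facets triangulated by pulling the points of \<open>V\<close> to
  generic heights close to \<open>1\<close>: its cones are spanned by the constraints tight at the vertices
  of the perturbed polar polytope.
\<close>

lemma boundary_fan_exists:
  fixes V :: "'a::euclidean_space set"
  assumes V: "finite V" and int0: "0 \<in> interior (convex hull V)"
  obtains T where "simplicial_fan T" "\<Union>T \<subseteq> V"
    "\<And>\<sigma>. \<sigma> \<in> T \<Longrightarrow> \<exists>g. (\<forall>u\<in>\<sigma>. g \<bullet> u = 1) \<and> (\<forall>v\<in>V. g \<bullet> v \<le> 1)"
proof (rule generic_heights_exist[OF V])
  fix h assume hpos: "\<And>v. v \<in> V \<Longrightarrow> 0 < h v"
    and generic: "\<And>\<sigma> v f. \<sigma> \<subseteq> V \<Longrightarrow> independent \<sigma> \<Longrightarrow> card \<sigma> = DIM('a) \<Longrightarrow> v \<in> V - \<sigma> \<Longrightarrow>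
      (\<And>u. u \<in> \<sigma> \<Longrightarrow> f \<bullet> u = h u) \<Longrightarrow> f \<bullet> v \<noteq> h v"
    and near: "\<And>\<sigma> v f g. \<sigma> \<subseteq> V \<Longrightarrow> independent \<sigma> \<Longrightarrow> card \<sigma> = DIM('a) \<Longrightarrow> v \<in> V - \<sigma> \<Longrightarrow> (\<And>u. u \<in> \<sigma> \<Longrightarrow> f \<bullet> u = h u) \<Longrightarrow>
      f \<bullet> v \<le> h v \<Longrightarrow> (\<And>u. u \<in> \<sigma> \<Longrightarrow> g \<bullet> u = 1) \<Longrightarrow> g \<bullet> v \<le> 1"
  define D where "D = {f. \<forall>v\<in>V. f \<bullet> v \<le> h v}"
  define tight where "tight f = {v\<in>V. f \<bullet> v = h v}" for f
  define T where "T = tight ` {f. f extreme_point_of D}"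
  have D_eq: "D = (\<Inter>v\<in>V. {f. v \<bullet> f \<le> h v})" by (auto simp: D_def inner_commute)
  have convD: "convex D" unfolding D_eq by (intro convex_INT convex_halfspace_le)
  have "closed D" unfolding D_eq by (intro closed_INT ballI closed_halfspace_le)
  moreover have "bounded D"
  proof -
    obtain r where r: "0 < r" "cball 0 r \<subseteq> convex hull V"
      using int0 mem_interior_cball by blast
    define H where "H = (\<Sum>v\<in>V. h v)"
    have hH: "h v \<le> H" if "v \<in> V" for v
      unfolding H_def using V that hpos by (intro member_le_sum) (auto intro: less_imp_le)
    have "norm f \<le> H / r" if "f \<in> D" for f
    proof -
      have "V \<subseteq> {x. f \<bullet> x \<le> H}" using that hH by (force simp: D_def)
      then have hull: "convex hull V \<subseteq> {x. f \<bullet> x \<le> H}" by (intro hull_minimal convex_halfspace_le)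
      have "(r / norm f) *\<^sub>R f \<in> cball 0 r" using r by simp
      then have "f \<bullet> ((r / norm f) *\<^sub>R f) \<le> H" using hull r(2) by blast
      moreover have "f \<bullet> ((r / norm f) *\<^sub>R f) = r * norm f"
        by (simp add: power2_norm_eq_inner[symmetric] power2_eq_square)
      ultimately show ?thesis using r by (simp add: field_simps)
    qed
    then show ?thesis by (auto intro: boundedI)
  qed
  ultimately have compD: "compact D" by (simp add: compact_eq_bounded_closed)
  have "0 \<in> D" using hpos by (auto simp: D_def intro: less_imp_le)
  \<comment> \<open>Feasible directions: constraints that are not tight have slack, so only the
    tight ones restrict a short move.\<close>
  have perturb: "\<forall>\<^sub>F \<epsilon> in at_right (0::real). f + \<epsilon> *\<^sub>R d \<in> D"
    if f: "f \<in> D" and d: "\<And>u. u \<in> tight f \<Longrightarrow> d \<bullet> u \<le> 0" for f d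
  proof -
    have "\<forall>\<^sub>F \<epsilon> in at_right (0::real). (f + \<epsilon> *\<^sub>R d) \<bullet> v \<le> h v" if v: "v \<in> V" for v
    proof (cases "v \<in> tight f")
      case True
      have "\<forall>\<^sub>F \<epsilon> in at_right (0::real). 0 < \<epsilon>" by (rule eventually_at_right_less)
      then show ?thesis
      proof eventually_elim
        case (elim \<epsilon>)
        then have "\<epsilon> * (d \<bullet> v) \<le> 0" using d[OF True] by (simp add: mult_nonneg_nonpos)
        then show ?case using True by (simp add: tight_def inner_add_left)
      qed
    next
      case False
      have "((\<lambda>\<epsilon>. (f + \<epsilon> *\<^sub>R d) \<bullet> v) \<longlongrightarrow> (f + 0 *\<^sub>R d) \<bullet> v) (at_right 0)" by (intro tendsto_intros)
      moreover have "(f + 0 *\<^sub>R d) \<bullet> v < h v" using False v f by (auto simp: tight_def D_def less_le)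
      ultimately have "\<forall>\<^sub>F \<epsilon> in at_right (0::real). (f + \<epsilon> *\<^sub>R d) \<bullet> v < h v" by (rule order_tendstoD(2))
      then show ?thesis by (rule eventually_mono) simp
    qed
    then have "\<forall>\<^sub>F \<epsilon> in at_right (0::real). \<forall>v\<in>V. (f + \<epsilon> *\<^sub>R d) \<bullet> v \<le> h v"
      using V by (simp add: eventually_ball_finite)
    then show ?thesis by (simp add: D_def)
  qed
  have basis: "independent (tight f) \<and> card (tight f) = DIM('a)" if ext: "f extreme_point_of D" for f
  proof -
    have fD: "f \<in> D" using ext by (simp add: extreme_point_of_def)
    \<comment> \<open>Otherwise a direction orthogonal to all tight points could be followed both
      ways, and \<open>f\<close> would be the midpoint of a segment in \<open>D\<close>.\<close>
    have "span (tight f) = UNIV"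
    proof (rule ccontr)
      assume "span (tight f) \<noteq> UNIV"
      then obtain d where d: "d \<noteq> 0" "\<And>x. x \<in> span (tight f) \<Longrightarrow> d \<bullet> x = 0"
        using span_not_UNIV_orthogonal by metis
      have "\<forall>\<^sub>F \<epsilon> in at_right (0::real). f + \<epsilon> *\<^sub>R d \<in> D"
        using d by (intro perturb fD) (simp add: span_base)
      moreover have "\<forall>\<^sub>F \<epsilon> in at_right (0::real). f + \<epsilon> *\<^sub>R (- d) \<in> D"
        using d by (intro perturb fD) (simp add: span_base)
      ultimately have "\<forall>\<^sub>F \<epsilon> in at_right (0::real). 0 < \<epsilon> \<and> f + \<epsilon> *\<^sub>R d \<in> D \<and> f + \<epsilon> *\<^sub>R (- d) \<in> D"
        using eventually_at_right_less by eventually_elim simp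
      then obtain \<epsilon> :: real where \<epsilon>: "0 < \<epsilon>" "f + \<epsilon> *\<^sub>R d \<in> D" "f + \<epsilon> *\<^sub>R (- d) \<in> D"
        using eventually_happens'[OF trivial_limit_at_right_real] by blast
      have "f = midpoint (f + \<epsilon> *\<^sub>R d) (f + \<epsilon> *\<^sub>R (- d))"
        by (simp add: midpoint_def scaleR_2[symmetric])
      moreover have "f + \<epsilon> *\<^sub>R d \<noteq> f + \<epsilon> *\<^sub>R (- d)"
      proof
        assume "f + \<epsilon> *\<^sub>R d = f + \<epsilon> *\<^sub>R (- d)"
        then have "(2 * \<epsilon>) *\<^sub>R d = 0" by (simp add: scaleR_2[symmetric] eq_neg_iff_add_eq_0)
        then show False using \<epsilon>(1) d(1) by simp
      qed
      ultimately have "f \<in> open_segment (f + \<epsilon> *\<^sub>R d) (f + \<epsilon> *\<^sub>R (- d))"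
        using midpoint_in_open_segment by metis
      then show False using ext \<epsilon> unfolding extreme_point_of_def by blast
    qed
    moreover obtain B where B: "B \<subseteq> tight f" "independent B" "tight f \<subseteq> span B" "card B = dim (tight f)"
      using basis_exists by blast
    ultimately have cB: "card B = DIM('a)" by (metis dim_UNIV dim_span)
    \<comment> \<open>The basis \<open>B\<close> already determines \<open>f\<close>; a further
      tight point would contradict genericity.\<close>
    have "tight f \<subseteq> B"
    proof
      fix v assume v: "v \<in> tight f"
      show "v \<in> B"
        using generic[of B v f] B cB v by (auto simp: tight_def)
    qed
    then have "tight f = B" using B by blast
    then show ?thesis using B cB by simp
  qed
  have fan: "simplicial_fan T"
  proof
    have "T \<subseteq> Pow V" by (auto simp: T_def tight_def)
    then show "finite T" using V finite_subset by blast
    show "independent \<sigma>" "card \<sigma> = DIM('a)" if "\<sigma> \<in> T" for \<sigma> using that basis by (auto simp: T_def)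
    show "pos_cone \<sigma> \<inter> pos_cone \<tau> \<subseteq> pos_cone (\<sigma> \<inter> \<tau>)" if st: "\<sigma> \<in> T" "\<tau> \<in> T" for \<sigma> \<tau>
    proof
      obtain f g where fg: "f \<in> D" "\<sigma> = tight f" "g \<in> D" "\<tau> = tight g"
        using st by (auto simp: T_def extreme_point_of_def)
      have fin: "finite \<sigma>" "finite \<tau>" using V fg by (simp_all add: tight_def)
      fix x assume x: "x \<in> pos_cone \<sigma> \<inter> pos_cone \<tau>"
      obtain c where c: "\<And>u. u \<in> \<sigma> \<Longrightarrow> 0 \<le> c u" "x = (\<Sum>u\<in>\<sigma>. c u *\<^sub>R u)"
        using x by (blast elim: pos_coneE)
      obtain d where d: "\<And>u. u \<in> \<tau> \<Longrightarrow> 0 \<le> d u" "x = (\<Sum>u\<in>\<tau>. d u *\<^sub>R u)"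
        using x by (blast elim: pos_coneE)
      \<comment> \<open>Expanding \<open>x\<close> over \<tau> gives
        \<open>f \<bullet> x \<le> g \<bullet> x\<close>, since \<open>g\<close> attains the heights
        on \<tau>. Over \<sigma> the roles are reversed, so every term
        \<open>c u * (f \<bullet> u - g \<bullet> u)\<close> vanishes.\<close>
      have "f \<bullet> x = (\<Sum>u\<in>\<tau>. d u * (f \<bullet> u))" by (simp add: d(2) inner_sum_right)
      also have "\<dots> \<le> (\<Sum>u\<in>\<tau>. d u * (g \<bullet> u))"
        using d fg by (intro sum_mono mult_left_mono) (auto simp: D_def tight_def)
      also have "\<dots> = g \<bullet> x" by (simp add: d(2) inner_sum_right)
      finally have "(\<Sum>u\<in>\<sigma>. c u * (f \<bullet> u - g \<bullet> u)) \<le> 0"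
        by (simp add: c(2) inner_sum_right algebra_simps sum_subtractf)
      moreover have nn: "0 \<le> c u * (f \<bullet> u - g \<bullet> u)" if "u \<in> \<sigma>" for u
        using that c(1)[OF that] fg by (intro mult_nonneg_nonneg) (auto simp: D_def tight_def)
      ultimately have "(\<Sum>u\<in>\<sigma>. c u * (f \<bullet> u - g \<bullet> u)) = 0" by (intro antisym sum_nonneg) auto
      then have z: "c u * (f \<bullet> u - g \<bullet> u) = 0" if "u \<in> \<sigma>" for u
        using sum_nonneg_eq_0_iff[OF fin(1), of "\<lambda>u. c u * (f \<bullet> u - g \<bullet> u)"] nn that by blast
      have c0: "c u = 0" if "u \<in> \<sigma> - \<tau>" for u
        using z[of u] that fg by (auto simp: tight_def)
      have "x = (\<Sum>u\<in>\<sigma> \<inter> \<tau>. c u *\<^sub>R u)"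
        unfolding c(2) using fin c0 by (intro sum.mono_neutral_right) auto
      then show "x \<in> pos_cone (\<sigma> \<inter> \<tau>)" using c(1) by (intro pos_coneI) auto
    qed
    show "(\<Union>\<sigma>\<in>T. pos_cone \<sigma>) = UNIV"
    proof (intro equalityI subsetI UNIV_I)
      fix y :: 'a
      \<comment> \<open>Linear programming duality: at a vertex of \<open>D\<close> maximizing
        \<open>y\<close>, the tight points express \<open>y\<close> with nonnegative coefficients. A
        negative coefficient at \<open>v\<close> would allow an improving move that slackens only
        the constraint of \<open>v\<close>.\<close>
      have "continuous_on D (\<lambda>f. y \<bullet> f)" by (intro continuous_intros)
      then obtain m where m: "m \<in> D" "\<And>f. f \<in> D \<Longrightarrow> y \<bullet> f \<le> y \<bullet> m"
        using continuous_attains_sup[OF compD, of "\<lambda>f. y \<bullet> f"] \<open>0 \<in> D\<close> by auto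
      let ?F = "D \<inter> {f. y \<bullet> f = y \<bullet> m}"
      have F: "?F face_of D" using face_of_Int_supporting_hyperplane_le[OF convD] m by blast
      have "compact ?F" by (rule face_of_imp_compact[OF convD compD F])
      moreover have "convex ?F" using F face_of_imp_convex by blast
      moreover have "?F \<noteq> {}" using m by auto
      ultimately obtain f where f: "f extreme_point_of ?F" using extreme_point_exists_convex by blast
      then have ext: "f extreme_point_of D" using extreme_point_of_face[OF F] by auto
      have fm: "f \<in> D" "y \<bullet> f = y \<bullet> m" using f unfolding extreme_point_of_def by auto
      have ind: "independent (tight f)" "card (tight f) = DIM('a)" using basis[OF ext] by auto
      obtain c where c: "y = (\<Sum>u\<in>tight f. c u *\<^sub>R u)" using basis_expansion[OF ind] .
      have "0 \<le> c v" if v: "v \<in> tight f" for v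
      proof (rule ccontr)
        assume neg: "\<not> 0 \<le> c v"
        obtain d where d: "\<And>u. u \<in> tight f \<Longrightarrow> d \<bullet> u = (if u = v then -1 else 0)"
          using independent_functional_exists[OF ind(1), of "\<lambda>u. if u = v then -1 else 0"] by metis
        have "\<forall>\<^sub>F \<epsilon> in at_right (0::real). f + \<epsilon> *\<^sub>R d \<in> D" by (intro perturb fm) (simp add: d)
        then have "\<forall>\<^sub>F \<epsilon> in at_right (0::real). 0 < \<epsilon> \<and> f + \<epsilon> *\<^sub>R d \<in> D"
          using eventually_at_right_less by eventually_elim simp
        then obtain \<epsilon> :: real where \<epsilon>: "0 < \<epsilon>" "f + \<epsilon> *\<^sub>R d \<in> D"
          using eventually_happens'[OF trivial_limit_at_right_real] by blast
        have "d \<bullet> y = (\<Sum>u\<in>tight f. if u = v then - c u else 0)"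
          unfolding c inner_sum_right by (intro sum.cong) (auto simp: d)
        also have "\<dots> = - c v" using v independent_imp_finite[OF ind(1)] by simp
        finally have "y \<bullet> (f + \<epsilon> *\<^sub>R d) = y \<bullet> m - \<epsilon> * c v"
          by (simp add: inner_add_right fm inner_commute[of y d])
        moreover have "\<epsilon> * c v < 0" using \<epsilon> neg by (simp add: mult_pos_neg)
        ultimately show False using m(2)[OF \<epsilon>(2)] by simp
      qed
      then have "y \<in> pos_cone (tight f)" using c by (rule pos_coneI)
      then show "y \<in> (\<Union>\<sigma>\<in>T. pos_cone \<sigma>)" using ext by (auto simp: T_def)
    qed
  qed
  show thesis
  proof (rule that[OF fan])
    show "\<Union>T \<subseteq> V" by (auto simp: T_def tight_def)
    fix \<sigma> assume \<sigma>: "\<sigma> \<in> T"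
    then obtain f where f: "f extreme_point_of D" "\<sigma> = tight f" by (auto simp: T_def)
    have fD: "f \<in> D" using f by (simp add: extreme_point_of_def)
    have ind: "independent \<sigma>" "card \<sigma> = DIM('a)" using basis f by auto
    \<comment> \<open>The functional of the unperturbed facet: the cell is moved back from its
      heights to height 1.\<close>
    obtain g where g: "\<And>u. u \<in> \<sigma> \<Longrightarrow> g \<bullet> u = 1"
      using independent_functional_exists[OF ind(1), of "\<lambda>_. 1"] by metis
    have "g \<bullet> v \<le> 1" if v: "v \<in> V" for v
    proof (cases "v \<in> \<sigma>")
      case False
      show ?thesis
        by (rule near[of \<sigma> v f g]) (use False v f fD ind g in \<open>auto simp: tight_def D_def\<close>)
    qed (simp add: g)
    then show "\<exists>g. (\<forall>u\<in>\<sigma>. g \<bullet> u = 1) \<and> (\<forall>v\<in>V. g \<bullet> v \<le> 1)" using g by blast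
  qed
qed

section \<open>Lattice points and volume\<close>

text \<open>Removing a shared point from one of the two sets leaves the union unchanged but lowers
  the sum of the cardinalities.\<close>

lemma disjoint_of_card_UN:
  assumes I: "finite I" "\<And>i. i \<in> I \<Longrightarrow> finite (X i)"
    and card: "card (\<Union>i\<in>I. X i) = (\<Sum>i\<in>I. card (X i))"
    and ij: "i \<in> I" "j \<in> I" "i \<noteq> j"
  shows "X i \<inter> X j = {}"
proof (rule ccontr)
  assume "X i \<inter> X j \<noteq> {}"
  then obtain x where x: "x \<in> X i" "x \<in> X j" by blast
  define Y where "Y = X(i := X i - {x})"
  have Yk: "Y k = (if k = i then X i - {x} else X k)" for k by (simp add: Y_def)
  have "(\<Union>k\<in>I. X k) \<subseteq> (\<Union>k\<in>I. Y k)"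
  proof
    fix y assume "y \<in> (\<Union>k\<in>I. X k)"
    then obtain k where k: "k \<in> I" "y \<in> X k" by blast
    show "y \<in> (\<Union>k\<in>I. Y k)"
    proof (cases "k = i \<and> y = x")
      case True
      then have "y \<in> Y j" using x ij by (simp add: Yk)
      then show ?thesis using ij by blast
    next
      case False
      then have "y \<in> Y k" using k by (auto simp: Yk)
      then show ?thesis using k by blast
    qed
  qed
  moreover have "finite (\<Union>k\<in>I. Y k)" using I by (auto simp: Yk)
  ultimately have "card (\<Union>k\<in>I. X k) \<le> card (\<Union>k\<in>I. Y k)" by (rule card_mono[rotated])
  also have "\<dots> \<le> (\<Sum>k\<in>I. card (Y k))" by (rule card_UN_le[OF I(1)])
  also have "\<dots> < (\<Sum>k\<in>I. card (X k))"
  proof (rule sum_strict_mono_ex1[OF I(1)])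
    show "\<forall>k\<in>I. card (Y k) \<le> card (X k)" using I(2) by (auto simp: Yk card_Diff_subset_Int intro: card_mono)
    show "\<exists>k\<in>I. card (Y k) < card (X k)"
      using psubset_card_mono[OF I(2)[OF ij(1)], of "X i - {x}"] x(1) ij(1) by (intro bexI[of _ i]) (auto simp only: Yk if_True simp_thms)
  qed
  finally show False using card by simp
qed

lemma convex_hull_insert_zero_subset_pos_cone:
  assumes "finite S"
  shows "convex hull (insert 0 S) \<subseteq> pos_cone S"
proof
  fix x assume "x \<in> convex hull (insert 0 S)"
  then obtain u where u: "\<And>s. s \<in> insert 0 S \<Longrightarrow> 0 \<le> u s" "x = (\<Sum>s\<in>insert 0 S. u s *\<^sub>R s)"
    using assms unfolding convex_hull_finite[OF finite.insertI[OF assms]] by blast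
  have "x = (\<Sum>s\<in>S. u s *\<^sub>R s)"
    unfolding u(2) using assms by (cases "0 \<in> S") (auto simp: insert_absorb)
  then show "x \<in> pos_cone S" using u(1) by (intro pos_coneI) auto
qed

lemma mem_convex_hull_insert_zero:
  fixes S :: "'a::real_vector set"
  assumes "finite S" and "\<And>u. u \<in> S \<Longrightarrow> 0 \<le> c u" "sum c S \<le> 1"
  shows "(\<Sum>u\<in>S. c u *\<^sub>R u) \<in> convex hull (insert 0 S)"
  using mem_convex_hull_insert[of S "1 - sum c S" c 0] assms by simp

lemma lattice_add: "x \<in> lattice \<Longrightarrow> y \<in> lattice \<Longrightarrow> x + y \<in> lattice"
  by (simp only: mem_lattice_iff vector_add_component) (blast intro: Ints_add)

lemma lattice_diff: "x \<in> lattice \<Longrightarrow> y \<in> lattice \<Longrightarrow> x - y \<in> lattice"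
  by (simp only: mem_lattice_iff vector_minus_component) (blast intro: Ints_diff)

lemma lattice_scale: "c \<in> \<int> \<Longrightarrow> x \<in> lattice \<Longrightarrow> c *\<^sub>R x \<in> lattice"
  by (simp only: mem_lattice_iff vector_scaleR_component real_scaleR_def) (blast intro: Ints_mult)

lemma zero_lattice: "0 \<in> lattice"
  by (simp only: mem_lattice_iff) simp

lemma lattice_sum: "(\<And>i. i \<in> I \<Longrightarrow> f i \<in> lattice) \<Longrightarrow> sum f I \<in> lattice"
  by (induction I rule: infinite_finite_induct) (simp_all add: zero_lattice lattice_add del: range_eqI)

lemma finite_lattice_Int:
  assumes "bounded (S :: (real ^ 'n) set)"
  shows "finite (lattice \<inter> S)"
proof -
  have "lattice \<inter> S = lattice_vec ` {m. lattice_vec m \<in> S}" by auto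
  then show ?thesis using finite_bounded_lattice_points[OF assms] by simp
qed

lemma card_lattice_Int: "card {m. lattice_vec m \<in> S} = card (lattice \<inter> S)"
proof -
  have "lattice \<inter> S = lattice_vec ` {m. lattice_vec m \<in> S}" by auto
  moreover have "inj_on lattice_vec {m. lattice_vec m \<in> S}" by (auto simp: inj_on_def)
  ultimately show ?thesis by (simp add: card_image)
qed

lemma measure_lebesgue_convex_hull:
  fixes S :: "'a::euclidean_space set"
  shows "finite S \<Longrightarrow> measure lebesgue (convex hull S) = measure lborel (convex hull S)"
  by (intro measure_completion) (simp add: borel_compact finite_imp_compact_convex_hull)

lemma lmeasurable_convex_hull_finite:
  fixes S :: "'a::euclidean_space set"
  shows "finite S \<Longrightarrow> convex hull S \<in> lmeasurable"
  by (simp add: lmeasurable_compact finite_imp_compact_convex_hull)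

lemma normalized_volume_simplex_pos:
  fixes S :: "(real ^ 'n::finite) set"
  assumes "independent S" "card S = CARD('n)"
  shows "0 < normalized_volume (insert 0 S)"
proof -
  have fin: "finite (insert 0 S)" using independent_imp_finite[OF assms(1)] by simp
  have "interior (convex hull (insert 0 S)) \<noteq> {}"
    using interior_simplex_nonempty[OF assms(1)] assms fin by auto
  then have "\<not> negligible (convex hull (insert 0 S))"
    using negligible_convex_interior[OF convex_convex_hull] by blast
  then have "measure lebesgue (convex hull (insert 0 S)) \<noteq> 0"
    using lmeasurable_convex_hull_finite[OF fin] negligible_iff_measure by blast
  then show ?thesis
    using measure_lebesgue_convex_hull[OF fin] by (simp add: normalized_volume_def zero_less_measure_iff)
qed

text \<open>\<open>supporting\<close> places each cell in a face \<open>g = 1\<close> of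
  \<open>convex hull V\<close>, so that the simplices over the cells fill out the polytope.\<close>

locale boundary_fan = simplicial_fan T
  for T :: "(real ^ 'n::finite) set set" +
  fixes V :: "(real ^ 'n) set"
  assumes finite_V: "finite V" and lattice_V: "V \<subseteq> lattice" and rays_subset: "\<Union>T \<subseteq> V"
    and zero_mem: "0 \<in> convex hull V"
    and supporting: "\<sigma> \<in> T \<Longrightarrow> \<exists>g. (\<forall>u\<in>\<sigma>. g \<bullet> u = 1) \<and> (\<forall>v\<in>V. g \<bullet> v \<le> 1)"
begin

lemma cell_subset: "\<sigma> \<in> T \<Longrightarrow> \<sigma> \<subseteq> V"
  using rays_subset by blast

lemma zero_notin_cell: "\<sigma> \<in> T \<Longrightarrow> 0 \<notin> \<sigma>"
  using independent_cell dependent_zero by blast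

lemma simplex_of_cell:
  assumes "\<sigma> \<in> T"
  shows "finite (insert 0 \<sigma>)" "card (insert 0 \<sigma>) = Suc CARD('n)" "insert 0 \<sigma> \<subseteq> lattice"
    "0 < normalized_volume (insert 0 \<sigma>)"
proof -
  show "finite (insert 0 \<sigma>)" using finite_cell[OF assms] by simp
  show "card (insert 0 \<sigma>) = Suc CARD('n)"
    using finite_cell[OF assms] card_cell[OF assms] zero_notin_cell[OF assms] by simp
  show "insert 0 \<sigma> \<subseteq> lattice" using cell_subset[OF assms] lattice_V zero_lattice by blast
  show "0 < normalized_volume (insert 0 \<sigma>)"
    using normalized_volume_simplex_pos[OF independent_cell[OF assms]] card_cell[OF assms] by simp
qed

text \<open>On the cone the supporting functional is the sum of the coefficients; as it is at most 1
  on the polytope, the missing weight can be given to 0.\<close>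

lemma hull_Int_pos_cone_subset:
  assumes \<sigma>: "\<sigma> \<in> T" and x: "x \<in> convex hull V" "x \<in> pos_cone \<sigma>"
  shows "x \<in> convex hull (insert 0 \<sigma>)"
proof -
  obtain g where g: "\<And>u. u \<in> \<sigma> \<Longrightarrow> g \<bullet> u = 1" "\<And>v. v \<in> V \<Longrightarrow> g \<bullet> v \<le> 1"
    using supporting[OF \<sigma>] by blast
  obtain c where c: "\<forall>u\<in>\<sigma>. 0 \<le> c u" "x = (\<Sum>u\<in>\<sigma>. c u *\<^sub>R u)"
    using x(2) unfolding pos_cone_def by blast
  have "convex hull V \<subseteq> {y. g \<bullet> y \<le> 1}"
    using g by (intro hull_minimal convex_halfspace_le) auto
  then have "g \<bullet> x \<le> 1" using x by blast
  moreover have "g \<bullet> x = sum c \<sigma>" unfolding c(2) inner_sum_right by (intro sum.cong) (auto simp: g)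
  ultimately show ?thesis
    unfolding c(2) using c(1) finite_cell[OF \<sigma>] by (intro mem_convex_hull_insert_zero) auto
qed

lemma simplex_subset_hull: "\<sigma> \<in> T \<Longrightarrow> convex hull (insert 0 \<sigma>) \<subseteq> convex hull V"
  using cell_subset zero_mem by (intro hull_minimal convex_convex_hull) (auto intro: hull_inc)

lemma hull_eq_Union: "convex hull V = (\<Union>\<sigma>\<in>T. convex hull (insert 0 \<sigma>))"
proof
  show "convex hull V \<subseteq> (\<Union>\<sigma>\<in>T. convex hull (insert 0 \<sigma>))"
  proof
    fix x assume x: "x \<in> convex hull V"
    have "x \<in> (\<Union>\<sigma>\<in>T. pos_cone \<sigma>)" unfolding cover by simp
    then show "x \<in> (\<Union>\<sigma>\<in>T. convex hull (insert 0 \<sigma>))" using hull_Int_pos_cone_subset x by blast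
  qed
qed (use simplex_subset_hull in blast)

text \<open>Two simplices overlap inside the span of their common generators, a proper subspace
  because distinct cells have equal size.\<close>

lemma sum_normalized_volume: "(\<Sum>\<sigma>\<in>T. normalized_volume (insert 0 \<sigma>)) = normalized_volume V"
proof -
  have "measure lebesgue (\<Union>\<sigma>\<in>T. convex hull (insert 0 \<sigma>))
      = (\<Sum>\<sigma>\<in>T. measure lebesgue (convex hull (insert 0 \<sigma>)))"
  proof (rule measure_negligible_finite_Union_image[OF finite_fan])
    show "convex hull (insert 0 \<sigma>) \<in> lmeasurable" if "\<sigma> \<in> T" for \<sigma>
      using lmeasurable_convex_hull_finite simplex_of_cell(1)[OF that] .
    show "pairwise (\<lambda>\<sigma> \<tau>. negligible (convex hull (insert 0 \<sigma>) \<inter> convex hull (insert 0 \<tau>))) T"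
    proof (rule pairwiseI)
      fix \<sigma> \<tau> assume st: "\<sigma> \<in> T" "\<tau> \<in> T" "\<sigma> \<noteq> \<tau>"
      have "convex hull (insert 0 \<sigma>) \<inter> convex hull (insert 0 \<tau>) \<subseteq> pos_cone \<sigma> \<inter> pos_cone \<tau>"
        using convex_hull_insert_zero_subset_pos_cone finite_cell st by blast
      also have "\<dots> \<subseteq> span (\<sigma> \<inter> \<tau>)" using meet[OF st(1,2)] pos_cone_subset_span by blast
      finally have sub: "convex hull (insert 0 \<sigma>) \<inter> convex hull (insert 0 \<tau>) \<subseteq> span (\<sigma> \<inter> \<tau>)" .
      have "\<sigma> \<inter> \<tau> \<noteq> \<sigma>"
        using st card_cell finite_cell by (metis card_subset_eq inf.absorb_iff2 inf_commute)
      then have "\<sigma> \<inter> \<tau> \<subset> \<sigma>" by blast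
      then have "card (\<sigma> \<inter> \<tau>) < DIM(real ^ 'n)"
        using psubset_card_mono[OF finite_cell[OF st(1)]] card_cell[OF st(1)] by metis
      then have "dim (span (\<sigma> \<inter> \<tau>)) < DIM(real ^ 'n)"
        using dim_le_card'[of "\<sigma> \<inter> \<tau>"] finite_cell[OF st(1)] by simp
      then have "negligible (span (\<sigma> \<inter> \<tau>))" by (rule negligible_lowdim)
      then show "negligible (convex hull (insert 0 \<sigma>) \<inter> convex hull (insert 0 \<tau>))"
        using negligible_subset sub by blast
    qed
  qed
  also have "\<dots> = (\<Sum>\<sigma>\<in>T. measure lborel (convex hull (insert 0 \<sigma>)))"
    by (intro sum.cong refl measure_lebesgue_convex_hull simplex_of_cell(1))
  finally have "measure lborel (convex hull V) = (\<Sum>\<sigma>\<in>T. measure lborel (convex hull (insert 0 \<sigma>)))"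
    unfolding hull_eq_Union[symmetric] measure_lebesgue_convex_hull[OF finite_V] .
  then show ?thesis by (simp add: normalized_volume_def sum_distrib_left)
qed

text \<open>A point on a common face belongs to the sets of several cells; disjointness is a
  consequence of equality in the volume bound.\<close>

definition new_points :: "(real ^ 'n) set \<Rightarrow> (real ^ 'n) set"
  where "new_points \<sigma> = lattice \<inter> convex hull (insert 0 \<sigma>) - insert 0 (\<Union>T)"

lemma new_points:
  assumes "\<sigma> \<in> T"
  shows "finite (new_points \<sigma>)" "new_points \<sigma> \<subseteq> lattice" "new_points \<sigma> \<subseteq> convex hull (insert 0 \<sigma>) - insert 0 \<sigma>"
  using finite_lattice_Int[OF finite_imp_bounded_convex_hull[OF simplex_of_cell(1)[OF assms]]] assms
  by (auto simp: new_points_def)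

lemma card_new_points_le:
  assumes "\<sigma> \<in> T" shows "1 + real (card (new_points \<sigma>)) \<le> normalized_volume (insert 0 \<sigma>)"
  by (rule normalized_volume_ge[OF simplex_of_cell[OF assms] new_points[OF assms]])

lemma card_lattice_points_le:
  "card (lattice \<inter> convex hull V) \<le> 1 + card (\<Union>T) + card (\<Union>\<sigma>\<in>T. new_points \<sigma>)"
proof -
  have fin: "finite (\<Union>\<sigma>\<in>T. new_points \<sigma>)" using finite_fan new_points(1) by blast
  have "lattice \<inter> convex hull V \<subseteq> insert 0 (\<Union>T) \<union> (\<Union>\<sigma>\<in>T. new_points \<sigma>)"
    unfolding hull_eq_Union new_points_def by blast
  then have "card (lattice \<inter> convex hull V) \<le> card (insert 0 (\<Union>T) \<union> (\<Union>\<sigma>\<in>T. new_points \<sigma>))"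
    using finite_rays fin by (intro card_mono) auto
  also have "\<dots> \<le> card (insert 0 (\<Union>T)) + card (\<Union>\<sigma>\<in>T. new_points \<sigma>)" by (rule card_Un_le)
  also have "card (insert 0 (\<Union>T)) \<le> 1 + card (\<Union>T)" by (simp add: card_insert_le_m1 card_insert_if finite_rays)
  finally show ?thesis by simp
qed

lemma card_new_points_Union_le: "card (\<Union>\<sigma>\<in>T. new_points \<sigma>) \<le> (\<Sum>\<sigma>\<in>T. card (new_points \<sigma>))"
  by (rule card_UN_le[OF finite_fan])

lemma sum_new_points_le: "real (card T) + real (\<Sum>\<sigma>\<in>T. card (new_points \<sigma>)) \<le> normalized_volume V"
proof -
  have "real (card T) + real (\<Sum>\<sigma>\<in>T. card (new_points \<sigma>)) = (\<Sum>\<sigma>\<in>T. 1 + real (card (new_points \<sigma>)))"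
    by (simp add: sum.distrib)
  also have "\<dots> \<le> (\<Sum>\<sigma>\<in>T. normalized_volume (insert 0 \<sigma>))" by (intro sum_mono card_new_points_le)
  finally show ?thesis by (simp add: sum_normalized_volume)
qed

lemma card_lattice_points_le_volume:
  "real (card (lattice \<inter> convex hull V)) \<le> 1 + normalized_volume V"
proof -
  have "card (lattice \<inter> convex hull V) \<le> 1 + card T + (\<Sum>\<sigma>\<in>T. card (new_points \<sigma>))"
    using card_lattice_points_le card_rays_le card_new_points_Union_le by linarith
  then have "real (card (lattice \<inter> convex hull V)) \<le> real (1 + card T + (\<Sum>\<sigma>\<in>T. card (new_points \<sigma>)))"
    by (rule of_nat_mono)
  then show ?thesis using sum_new_points_le by simp
qed

text \<open>Lattice points are at most 1 + rays + new points, which is at most 1 + cells + the sum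
  of the new points per cell, which is at most 1 + volume. Equality of the ends makes every link an
  equality, the last one cell by cell.\<close>

lemma tight:
  assumes eq: "real (card (lattice \<inter> convex hull V)) = 1 + normalized_volume V"
  shows "card (\<Union>T) = card T"
    and "card (\<Union>\<sigma>\<in>T. new_points \<sigma>) = (\<Sum>\<sigma>\<in>T. card (new_points \<sigma>))"
    and "\<sigma> \<in> T \<Longrightarrow> normalized_volume (insert 0 \<sigma>) = 1 + real (card (new_points \<sigma>))"
proof -
  have "real (1 + card T + (\<Sum>\<sigma>\<in>T. card (new_points \<sigma>))) \<le> real (card (lattice \<inter> convex hull V))"
    using sum_new_points_le eq by simp
  then have ge: "1 + card T + (\<Sum>\<sigma>\<in>T. card (new_points \<sigma>)) \<le> card (lattice \<inter> convex hull V)"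
    by (simp only: of_nat_le_iff)
  then show "card (\<Union>T) = card T" "card (\<Union>\<sigma>\<in>T. new_points \<sigma>) = (\<Sum>\<sigma>\<in>T. card (new_points \<sigma>))"
    using card_lattice_points_le card_rays_le card_new_points_Union_le by linarith+
  have "card (lattice \<inter> convex hull V) = 1 + card T + (\<Sum>\<sigma>\<in>T. card (new_points \<sigma>))"
    using ge card_lattice_points_le card_rays_le card_new_points_Union_le by linarith
  then have "(\<Sum>\<sigma>\<in>T. 1 + real (card (new_points \<sigma>))) = (\<Sum>\<sigma>\<in>T. normalized_volume (insert 0 \<sigma>))"
    using eq by (simp add: sum.distrib sum_normalized_volume)
  then have "(\<Sum>\<sigma>\<in>T. normalized_volume (insert 0 \<sigma>) - (1 + real (card (new_points \<sigma>)))) = 0"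
    by (simp add: sum_subtractf)
  moreover have "\<forall>\<sigma>\<in>T. 0 \<le> normalized_volume (insert 0 \<sigma>) - (1 + real (card (new_points \<sigma>)))"
    using card_new_points_le by force
  ultimately have "\<forall>\<sigma>\<in>T. normalized_volume (insert 0 \<sigma>) - (1 + real (card (new_points \<sigma>))) = 0"
    using sum_nonneg_eq_0_iff[OF finite_fan] by (metis (no_types, lifting))
  then show "normalized_volume (insert 0 \<sigma>) = 1 + real (card (new_points \<sigma>))" if "\<sigma> \<in> T"
    using that by force
qed

text \<open>
  In the extremal case a further lattice point \<open>x\<close> would lie on an edge of its simplex. Since
  \<open>n \<ge> 3\<close>, that edge is contained in a facet shared with a second simplex, so \<open>x\<close> is counted twice.
\<close>

lemma no_new_points:
  assumes eq: "real (card (lattice \<inter> convex hull V)) = 1 + normalized_volume V"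
    and dim: "3 \<le> CARD('n)" and \<sigma>: "\<sigma> \<in> T"
  shows "new_points \<sigma> = {}"
proof (rule ccontr)
  assume "new_points \<sigma> \<noteq> {}"
  then obtain x where x: "x \<in> new_points \<sigma>" by blast
  note S = simplex_of_cell[OF \<sigma>] and X = new_points[OF \<sigma>]
  obtain u where u: "\<And>s. s \<in> insert 0 \<sigma> \<Longrightarrow> 0 \<le> u s" "sum u (insert 0 \<sigma>) = 1"
      "x = (\<Sum>t\<in>insert 0 \<sigma>. u t *\<^sub>R t)"
    using x X(3) unfolding convex_hull_finite[OF S(1)] by blast
  have "real (card {s\<in>insert 0 \<sigma>. 0 < u s}) + real (card (new_points \<sigma>)) - 1 \<le> normalized_volume (insert 0 \<sigma>)"
    by (rule normalized_volume_ge_support[OF S X x u])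
  \<comment> \<open>Equality in the simplex over \<sigma> leaves at most two vertices, possibly
    including 0, in the support of \<open>x\<close>; as \<open>n \<ge> 3\<close>, some generator
    \<open>v\<close> has weight 0.\<close>
  then have "card {s\<in>insert 0 \<sigma>. 0 < u s} \<le> 2" using tight(3)[OF eq \<sigma>] by simp
  moreover have "card {s\<in>\<sigma>. 0 < u s} \<le> card {s\<in>insert 0 \<sigma>. 0 < u s}"
    using S(1) by (intro card_mono) auto
  ultimately have "card {s\<in>\<sigma>. 0 < u s} < card \<sigma>" using dim card_cell[OF \<sigma>] by simp
  then have "{s\<in>\<sigma>. 0 < u s} \<noteq> \<sigma>" by (metis less_irrefl)
  then obtain v where v: "v \<in> \<sigma>" "\<not> 0 < u v" by blast
  then have uv: "u v = 0" using u(1)[of v] by simp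
  \<comment> \<open>The star bound for a face with \<open>n - 1\<close> generators yields
    \<open>n + 1 - (n - 1) = 2\<close> cells.\<close>
  have "DIM(real ^ 'n) + 1 \<le> card {\<tau>\<in>T. \<sigma> - {v} \<subseteq> \<tau>} + card (\<sigma> - {v})"
    using card_star_ge[OF \<sigma>, of "\<sigma> - {v}"] by blast
  moreover have "card (\<sigma> - {v}) = DIM(real ^ 'n) - 1"
    using card_cell[OF \<sigma>] v finite_cell[OF \<sigma>] by simp
  ultimately have two: "2 \<le> card {\<tau>\<in>T. \<sigma> - {v} \<subseteq> \<tau>}" by simp
  have "\<not> {\<tau>\<in>T. \<sigma> - {v} \<subseteq> \<tau>} \<subseteq> {\<sigma>}"
  proof
    assume "{\<tau>\<in>T. \<sigma> - {v} \<subseteq> \<tau>} \<subseteq> {\<sigma>}"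
    then have "card {\<tau>\<in>T. \<sigma> - {v} \<subseteq> \<tau>} \<le> card {\<sigma>}" by (intro card_mono) auto
    then show False using two by simp
  qed
  then obtain \<tau> where \<tau>: "\<tau> \<in> T" "\<sigma> - {v} \<subseteq> \<tau>" "\<tau> \<noteq> \<sigma>" by blast
  have "v \<noteq> 0" using zero_notin_cell[OF \<sigma>] v by auto
  have fin\<sigma>: "finite \<sigma>" by (rule finite_cell[OF \<sigma>])
  have u0: "u 0 + sum u \<sigma> = 1" "0 \<le> u 0"
    using u(1,2) fin\<sigma> zero_notin_cell[OF \<sigma>] by auto
  have "x = (\<Sum>t\<in>\<sigma>. u t *\<^sub>R t)" unfolding u(3) using fin\<sigma> zero_notin_cell[OF \<sigma>] by simp
  also have "\<dots> = (\<Sum>t\<in>\<sigma> - {v}. u t *\<^sub>R t)"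
    using fin\<sigma> uv v by (simp add: sum_diff1)
  also have "\<dots> \<in> convex hull (insert 0 (\<sigma> - {v}))"
  proof (rule mem_convex_hull_insert_zero)
    have "sum u \<sigma> \<le> 1" using u0 by linarith
    then show "sum u (\<sigma> - {v}) \<le> 1" using fin\<sigma> v uv by (simp add: sum_diff1)
  qed (use u(1) fin\<sigma> in auto)
  also have "\<dots> \<subseteq> convex hull (insert 0 \<tau>)" using \<tau>(2) by (intro hull_mono) auto
  finally have "x \<in> new_points \<tau>" using x by (simp add: new_points_def)
  moreover have "new_points \<sigma> \<inter> new_points \<tau> = {}"
    by (rule disjoint_of_card_UN[OF finite_fan new_points(1) tight(2)[OF eq] \<sigma> \<tau>(1)]) (use \<tau> in auto)
  ultimately show False using x by blast
qed

text \<open>Let \<open>w\<close> be the ray outside \<sigma>. Exchanging a generator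
  \<open>v\<close> of \<sigma> for \<open>w\<close> gives again a unimodular cell, so the
  coefficient of \<open>w\<close> at \<open>v\<close> is 1 or -1; the value 1 would make two cones
  overlap.\<close>

lemma tight_simplex:
  assumes eq: "real (card (lattice \<inter> convex hull V)) = 1 + normalized_volume V"
    and dim: "3 \<le> CARD('n)"
  obtains \<sigma> where "\<sigma> \<in> T" "normalized_volume (insert 0 \<sigma>) = 1"
    "convex hull V = convex hull (insert (- \<Sum>\<sigma>) \<sigma>)"
proof -
  have unit: "normalized_volume (insert 0 \<sigma>) = 1" if "\<sigma> \<in> T" for \<sigma>
    using tight(3)[OF eq that] no_new_points[OF eq dim that] by simp
  have W: "card (\<Union>T) = CARD('n) + 1" and T: "T = {\<sigma>. \<sigma> \<subseteq> \<Union>T \<and> card \<sigma> = CARD('n)}"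
    using fan_tight tight(1)[OF eq] dim by auto
  have "\<Union>T \<noteq> {}" using W by (metis card.empty add_is_0 zero_neq_one)
  then obtain w where w: "w \<in> \<Union>T" by blast
  have cellI: "\<Union>T - {v} \<in> T" if "v \<in> \<Union>T" for v
  proof -
    have "card (\<Union>T - {v}) = CARD('n)" using that W finite_rays by (simp del: Union_iff)
    then show ?thesis using T by blast
  qed
  define \<sigma> where "\<sigma> = \<Union>T - {w}"
  have \<sigma>: "\<sigma> \<in> T" "w \<notin> \<sigma>" using cellI[OF w] by (auto simp: \<sigma>_def)
  have fin: "finite \<sigma>" by (rule finite_cell[OF \<sigma>(1)])
  have ind: "independent \<sigma>" "card \<sigma> = DIM(real ^ 'n)" using independent_cell card_cell \<sigma> by auto
  have z: "0 \<notin> \<sigma>" "w \<noteq> 0" using zero_notin_cell \<sigma> w by auto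
  obtain a where a: "w = (\<Sum>u\<in>\<sigma>. a u *\<^sub>R u)" using basis_expansion[OF ind] .
  define \<tau> where "\<tau> v = insert w (\<sigma> - {v})" for v
  have \<tau>: "\<tau> v \<in> T" if v: "v \<in> \<sigma>" for v
  proof -
    have "\<tau> v = \<Union>T - {v}" using v w by (auto simp: \<tau>_def \<sigma>_def)
    then show ?thesis using cellI[of v] v by (auto simp: \<sigma>_def)
  qed
  have abs1: "\<bar>a v\<bar> = 1" if v: "v \<in> \<sigma>" for v
  proof -
    have "v \<noteq> 0" using v z by auto
    \<comment> \<open>The vertex 0 absorbs the difference to total weight 1, which turns linear into
      barycentric coordinates.\<close>
    define u where "u = a(0 := 1 - sum a \<sigma>)"
    have ua: "sum u \<sigma> = sum a \<sigma>" "(\<Sum>t\<in>\<sigma>. u t *\<^sub>R t) = (\<Sum>t\<in>\<sigma>. a t *\<^sub>R t)"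
      using z by (auto simp: u_def intro!: sum.cong)
    have "normalized_volume (insert w (insert 0 \<sigma> - {v})) = \<bar>u v\<bar> * normalized_volume (insert 0 \<sigma>)"
    proof (rule normalized_volume_replace[OF simplex_of_cell(1,2)[OF \<sigma>(1)]])
      show "sum u (insert 0 \<sigma>) = 1" using fin z ua by (simp add: u_def)
      show "w = (\<Sum>t\<in>insert 0 \<sigma>. u t *\<^sub>R t)" using fin z ua a by simp
    qed (use v z \<sigma> in auto)
    moreover have "insert w (insert 0 \<sigma> - {v}) = insert 0 (\<tau> v)" using \<open>v \<noteq> 0\<close> by (auto simp: \<tau>_def)
    ultimately show ?thesis using unit[OF \<tau>[OF v]] unit[OF \<sigma>(1)] \<open>v \<noteq> 0\<close> by (simp add: u_def)
  qed
  have "a v = -1" if v: "v \<in> \<sigma>" for v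
  proof -
    have "a v \<noteq> 1"
    proof
      assume av: "a v = 1"
      \<comment> \<open>The coefficients of \<open>\<Sum>(\<tau> v)\<close> over \<sigma>. Off
        \<open>v\<close> the value \<open>a t \<ge> -1\<close> is raised by 1, and at
        \<open>v\<close> it is 1, so all are nonnegative: an interior point of another cone would
        lie in the cone of \<sigma>.\<close>
      define c where "c t = a t + (if t = v then 0 else 1)" for t
      have "\<Sum>(\<tau> v) = w + \<Sum>(\<sigma> - {v})" unfolding \<tau>_def using fin \<sigma> by (subst sum.insert) auto
      also have "\<Sum>(\<sigma> - {v}) = (\<Sum>t\<in>\<sigma>. (if t = v then 0 else 1) *\<^sub>R t)"
        using fin by (intro sum.mono_neutral_cong_left) auto
      finally have "\<Sum>(\<tau> v) = (\<Sum>t\<in>\<sigma>. c t *\<^sub>R t)"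
        by (simp add: a c_def scaleR_add_left sum.distrib)
      moreover have "0 \<le> c t" if "t \<in> \<sigma>" for t using abs1[OF that] av by (auto simp: c_def)
      ultimately have "\<Sum>(\<tau> v) \<in> pos_cone \<sigma>" by (intro pos_coneI)
      then have "\<tau> v \<subseteq> \<sigma>" by (rule sum_face_mem_pos_cone[OF \<tau>[OF v] subset_refl \<sigma>(1)])
      then show False using \<sigma> by (auto simp: \<tau>_def)
    qed
    then show ?thesis using abs1[OF v] by linarith
  qed
  then have w_eq: "w = - \<Sum>\<sigma>" unfolding a by (simp add: sum_negf)
  have W_eq: "insert w \<sigma> = \<Union>T" using w by (auto simp: \<sigma>_def)
  have "convex hull V = convex hull (\<Union>T)"
  proof
    have "0 \<in> convex hull (\<Union>T)"
    proof -
      let ?N = "real (CARD('n) + 1)"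
      have "(\<Sum>t\<in>\<Union>T. (1 / ?N) *\<^sub>R t) \<in> convex hull (\<Union>T)"
        using finite_rays W by (intro convex_sum convex_convex_hull) (auto intro: hull_inc)
      also have "(\<Sum>t\<in>\<Union>T. (1 / ?N) *\<^sub>R t) = (1 / ?N) *\<^sub>R (\<Sum>t\<in>insert w \<sigma>. t)"
        unfolding W_eq by (rule scaleR_sum_right[symmetric])
      also have "(\<Sum>t\<in>insert w \<sigma>. t) = 0" using fin \<sigma>(2) w_eq by (subst sum.insert) auto
      finally show ?thesis by simp
    qed
    then have "convex hull (insert 0 \<rho>) \<subseteq> convex hull (\<Union>T)" if "\<rho> \<in> T" for \<rho>
      using that by (intro hull_minimal convex_convex_hull) (auto intro: hull_inc)
    then show "convex hull V \<subseteq> convex hull (\<Union>T)" unfolding hull_eq_Union by blast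
    show "convex hull (\<Union>T) \<subseteq> convex hull V" by (intro hull_mono rays_subset)
  qed
  then show thesis using that[OF \<sigma>(1) unit[OF \<sigma>(1)]] W_eq w_eq by simp
qed

end

section \<open>Unimodular simplices and lattice bases\<close>

lemma lattice_point_coeff_in_Ints:
  fixes S :: "(real ^ 'n::finite) set"
  assumes S: "independent S" "card S = CARD('n)" "S \<subseteq> lattice" and unit: "normalized_volume (insert 0 S) = 1"
    and y: "(\<Sum>u\<in>S. c u *\<^sub>R u) \<in> lattice" and v: "v \<in> S"
  shows "c v \<in> \<int>"
proof -
  have fin: "finite S" by (rule independent_imp_finite[OF S(1)])
  have z: "0 \<notin> S" using S(1) dependent_zero by blast
  then have v0: "v \<noteq> 0" using v by auto
  \<comment> \<open>Reduction modulo integral combinations of \<open>S\<close> leaves a lattice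
    point \<open>x\<close> with coefficients in \<open>[0, 1)\<close>. Exchanging \<open>v\<close>
    for \<open>x\<close> gives a lattice simplex of normalized volume \<open>f v\<close>, an integer
    below 1.\<close>
  define f where "f u = frac (c u)" for u
  define x where "x = (\<Sum>u\<in>S. f u *\<^sub>R u)"
  have "x = (\<Sum>u\<in>S. c u *\<^sub>R u) - (\<Sum>u\<in>S. of_int \<lfloor>c u\<rfloor> *\<^sub>R u)"
    by (simp add: x_def f_def frac_def scaleR_diff_left sum_subtractf)
  moreover have "(\<Sum>u\<in>S. of_int \<lfloor>c u\<rfloor> *\<^sub>R u) \<in> lattice"
    using S(3) by (intro lattice_sum lattice_scale) auto
  ultimately have xL: "x \<in> lattice" by (simp only: lattice_diff[OF y])
  have "x \<notin> S"
  proof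
    assume "x \<in> S"
    have "(\<Sum>u\<in>S. (if u = y then 1 else 0) *\<^sub>R u) = (\<Sum>u\<in>S. if u = y then u else 0)" for y
      by (intro sum.cong refl) simp
    then have "(\<Sum>u\<in>S. (if u = x then 1 else 0) *\<^sub>R u) = (\<Sum>u\<in>S. if u = x then u else 0)" .
    also have "\<dots> = x" using fin \<open>x \<in> S\<close> by (simp only: sum.delta' sum.delta if_True)
    also have "x = (\<Sum>u\<in>S. f u *\<^sub>R u)" by (rule x_def)
    finally have "f x = (if x = x then 1 else 0)"
      by (rule independent_coeff_unique[OF S(1) sym \<open>x \<in> S\<close>])
    then show False using frac_lt_1[of "c x"] by (simp add: f_def)
  qed
  have "f v = 0"
  \<comment> \<open>For \<open>x = 0\<close> the exchange would lose a vertex; independence settles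
    this case.\<close>
  proof (cases "x = 0")
    case True
    then have "(\<Sum>u\<in>S. f u *\<^sub>R u) = (\<Sum>u\<in>S. 0 *\<^sub>R u)" by (simp add: x_def)
    then show ?thesis by (rule independent_coeff_unique[OF S(1) _ v])
  next
    case False
    define u where "u = f(0 := 1 - sum f S)"
    have uf: "sum u S = sum f S" "(\<Sum>t\<in>S. u t *\<^sub>R t) = x"
      using z by (auto simp: u_def x_def intro!: sum.cong)
    let ?S = "insert x (insert 0 S - {v})"
    have "normalized_volume ?S = \<bar>u v\<bar> * normalized_volume (insert 0 S)"
    proof (rule normalized_volume_replace)
      show "sum u (insert 0 S) = 1" using fin z uf by (simp add: u_def)
      show "x = (\<Sum>t\<in>insert 0 S. u t *\<^sub>R t)" using fin z uf by simp
    qed (use fin z S v False \<open>x \<notin> S\<close> in auto)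
    then have "normalized_volume ?S = f v" using unit v0 by (simp add: u_def f_def)
    moreover have "normalized_volume ?S \<in> \<int>"
    proof (rule normalized_volume_in_Ints)
      show "card ?S = Suc CARD('n)" using fin z S(2) v v0 False \<open>x \<notin> S\<close> by (simp add: insert_Diff_if)
      show "?S \<subseteq> lattice" using S(3) xL zero_lattice by blast
    qed (use fin in simp)
    ultimately have "f v \<in> \<int>" by simp
    then show ?thesis using frac_eq_0_iff[of "c v"] frac_in_Ints_iff[of "c v"] by (simp add: f_def)
  qed
  then show ?thesis by (simp add: f_def frac_eq_0_iff)
qed

lemma matrix_of_basis:
  fixes S :: "(real ^ 'n::finite) set"
  assumes S: "independent S" "card S = CARD('n)" "S \<subseteq> lattice" and unit: "normalized_volume (insert 0 S) = 1"
  obtains B :: "real ^ 'n ^ 'n" where "invertible B" "(*v) B ` lattice = lattice"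
    "(*v) B ` mirror_polytope = convex hull (insert (- \<Sum>S) S)"
proof -
  obtain b :: "'n \<Rightarrow> _" where b: "bij_betw b UNIV S"
    using bij_betw_UNIV_exists[OF independent_imp_finite[OF S(1)] S(2)] .
  have inj: "inj b" and ran: "range b = S" using b by (auto simp: bij_betw_def)
  define B :: "real ^ 'n ^ 'n" where "B = (\<chi> i j. b j $ i)"
  have Bx: "B *v x = (\<Sum>j\<in>UNIV. x $ j *\<^sub>R b j)" for x
    by (simp add: vec_eq_iff B_def matrix_vector_mult_def mult.commute)
  have onto: "\<exists>x. y = B *v x \<and> (y \<in> lattice \<longrightarrow> x \<in> lattice)" for y
  proof -
    obtain c where c: "y = (\<Sum>u\<in>S. c u *\<^sub>R u)" using basis_expansion[OF S(1)] S(2) by auto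
    let ?x = "\<chi> j. c (b j)"
    have "(\<Sum>j\<in>UNIV. c (b j) *\<^sub>R b j) = (\<Sum>u\<in>S. c u *\<^sub>R u)"
      by (rule sum.reindex_bij_betw[OF b])
    then have "y = B *v ?x" unfolding c Bx by simp
    moreover have "?x \<in> lattice" if "y \<in> lattice"
    proof -
      have "c (b j) \<in> \<int>" for j
        using lattice_point_coeff_in_Ints[OF S unit, of c] that ran unfolding c by blast
      then show ?thesis unfolding mem_lattice_iff by simp
    qed
    ultimately show ?thesis by blast
  qed
  show thesis
  proof (rule that)
    have "surj ((*v) B)" using onto by (metis surjI surj_def)
    then show "invertible B"
      using matrix_right_invertible_surjective invertible_right_inverse by blast
    have BL: "B *v x \<in> lattice" if "x \<in> lattice" for x
      unfolding Bx using that S(3) ran mem_lattice_iff[of x] by (intro lattice_sum lattice_scale) blast+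
    show "(*v) B ` lattice = lattice"
    proof
      show "(*v) B ` lattice \<subseteq> lattice" using BL by blast
      show "lattice \<subseteq> (*v) B ` lattice" using onto by blast
    qed
    have "B *v axis i 1 = b i" for i
      by (simp add: vec_eq_iff B_def matrix_vector_mult_basis column_def)
    then have "(*v) B ` insert (- (\<Sum>i\<in>UNIV. axis i 1)) (range (\<lambda>i. axis i 1)) = insert (- (\<Sum>i\<in>UNIV. b i)) (range b)"
      by (simp add: image_image linear_neg linear_sum[OF matrix_vector_mul_linear] linear_neg[OF matrix_vector_mul_linear])
    moreover have "(\<Sum>i\<in>UNIV. b i) = \<Sum>S" by (rule sum.reindex_bij_betw[OF b, of "\<lambda>x. x"])
    ultimately show "(*v) B ` mirror_polytope = convex hull (insert (- \<Sum>S) S)"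
      unfolding mirror_polytope_def convex_hull_linear_image[OF matrix_vector_mul_linear] by (simp add: ran)
  qed
qed

lemma boundary_fan_ex:
  fixes V :: "(real ^ 'n::finite) set"
  assumes V: "finite V" "V \<subseteq> lattice" and int0: "0 \<in> interior (convex hull V)"
  obtains T where "boundary_fan T V"
proof (rule boundary_fan_exists[OF V(1) int0])
  fix T assume T: "simplicial_fan T" "\<Union>T \<subseteq> V"
    "\<And>\<sigma>. \<sigma> \<in> T \<Longrightarrow> \<exists>g. (\<forall>u\<in>\<sigma>. g \<bullet> u = 1) \<and> (\<forall>v\<in>V. g \<bullet> v \<le> 1)"
  have "0 \<in> convex hull V" using int0 interior_subset by blast
  then have "boundary_fan T V"
    using T V by (intro boundary_fan.intro boundary_fan_axioms.intro) auto
  then show thesis by (rule that)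
qed

section \<open>The mirror simplex\<close>

abbreviation mirror_vertices :: "(real ^ 'n) set"
  where "mirror_vertices \<equiv> insert (- (\<Sum>i\<in>UNIV. axis i 1)) (range (\<lambda>i. axis i 1))"

lemma mirror_vertices:
  shows "- (\<Sum>i\<in>UNIV. axis i 1) \<notin> range (\<lambda>i::'n. axis i 1 :: real ^ 'n::finite)" (is "?m \<notin> range ?e")
    and "0 \<notin> (mirror_vertices :: (real ^ 'n) set)"
    and "card (mirror_vertices :: (real ^ 'n) set) = Suc CARD('n)"
    and "\<Sum>(mirror_vertices :: (real ^ 'n) set) = 0"
    and "(mirror_vertices :: (real ^ 'n) set) \<subseteq> lattice"
proof -
  have inj: "inj ?e" by (auto simp: inj_on_def axis_eq_axis)
  have nth: "?m $ j = -1" for j by (simp add: axis_def)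
  show m: "?m \<notin> range ?e"
  proof
    assume "?m \<in> range ?e"
    then obtain i where "?m = ?e i" by blast
    then have "?m $ i = ?e i $ i" by simp
    then show False unfolding nth by simp
  qed
  have "?m \<noteq> 0" using nth by (metis neg_equal_0_iff_equal zero_index zero_neq_one)
  then show "0 \<notin> (mirror_vertices :: (real ^ 'n) set)" by auto
  show "card (mirror_vertices :: (real ^ 'n) set) = Suc CARD('n)" using m by (simp add: card_image[OF inj])
  show "\<Sum>(mirror_vertices :: (real ^ 'n) set) = 0"
    using m by (subst sum.insert) (simp_all add: sum.reindex[OF inj])
  have "?m \<in> lattice" unfolding mem_lattice_iff using nth by simp
  moreover have "?e i \<in> lattice" for i unfolding mem_lattice_iff by (simp add: axis_def)
  ultimately show "(mirror_vertices :: (real ^ 'n) set) \<subseteq> lattice" by blast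
qed

text \<open>0 is the barycentre of the \<open>n + 1\<close> vertices, so exchanging one of them for
  it divides the volume by \<open>n + 1\<close> and leaves the standard simplex.\<close>

lemma normalized_volume_mirror:
  "normalized_volume (mirror_vertices :: (real ^ 'n::finite) set) = real CARD('n) + 1"
  (is "normalized_volume ?S = _")
proof -
  let ?m = "- (\<Sum>i\<in>UNIV. axis i 1) :: real ^ 'n"
  have "normalized_volume (insert 0 (?S - {?m})) = \<bar>1 / (real CARD('n) + 1)\<bar> * normalized_volume ?S"
  proof (rule normalized_volume_replace[where u = "\<lambda>_. 1 / (real CARD('n) + 1)"])
    show "(\<Sum>t\<in>?S. 1 / (real CARD('n) + 1)) = 1" unfolding sum_constant mirror_vertices(3) by simp
    show "0 = (\<Sum>t\<in>?S. (1 / (real CARD('n) + 1)) *\<^sub>R t)"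
      by (simp only: scaleR_sum_right[symmetric] mirror_vertices(4) scaleR_zero_right)
    show "card ?S = Suc CARD('n)" by (rule mirror_vertices(3))
    show "0 \<notin> ?S - {?m}" using mirror_vertices(2) by blast
  qed auto
  moreover have "insert 0 (?S - {?m}) = insert 0 Basis"
    using mirror_vertices(1)[where 'n = 'n] by (auto simp: Basis_vec_def)
  moreover have "normalized_volume (insert 0 Basis :: (real ^ 'n) set) = 1"
    by (simp add: normalized_volume_def content_std_simplex)
  ultimately show ?thesis by (simp add: field_simps)
qed

text \<open>With normalized volume \<open>n + 1\<close>, this count bounds the genus from above by
  \<open>n - 1\<close>; the general inequality is the reverse bound.\<close>

lemma card_lattice_mirror: "CARD('n::finite) + 2 \<le> card (lattice \<inter> (mirror_polytope :: (real ^ 'n) set))"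
proof -
  let ?S = "mirror_vertices :: (real ^ 'n) set"
  have card2: "card (insert 0 ?S) = CARD('n) + 2"
    using mirror_vertices(2,3)[where 'n = 'n] by (subst card_insert_disjoint) simp_all
  have "(\<Sum>t\<in>?S. (1 / (real CARD('n) + 1)) *\<^sub>R t) \<in> convex hull ?S"
  proof (rule convex_sum[OF _ convex_convex_hull])
    show "(\<Sum>t\<in>?S. 1 / (real CARD('n) + 1)) = 1" unfolding sum_constant mirror_vertices(3) by simp
  qed (auto intro: hull_inc)
  then have "0 \<in> convex hull ?S"
    by (simp only: scaleR_sum_right[symmetric] mirror_vertices(4) scaleR_zero_right)
  then have sub: "insert 0 ?S \<subseteq> lattice \<inter> mirror_polytope"
    using mirror_vertices(5)[where 'n = 'n] zero_lattice hull_subset[of ?S convex]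
    unfolding mirror_polytope_def by blast
  have "finite (lattice \<inter> (mirror_polytope :: (real ^ 'n) set))"
    unfolding mirror_polytope_def by (intro finite_lattice_Int finite_imp_bounded_convex_hull finite.insertI finite_imageI finite)
  from card_mono[OF this sub] show ?thesis unfolding card2 .
qed

section \<open>Invariance under lattice isomorphisms\<close>

lemma lattice_isomorphic_card_scaled:
  fixes A :: "real ^ 'n::finite ^ 'n"
  assumes bij: "bij (\<lambda>x. A *v x + b)" and L: "(\<lambda>x. A *v x + b) ` lattice = lattice"
    and Q: "(\<lambda>x. A *v x + b) ` P = Q"
  shows "card (lattice \<inter> (\<lambda>y. real k *\<^sub>R y) ` P) = card (lattice \<inter> (\<lambda>y. real k *\<^sub>R y) ` Q)"
proof -
  \<comment> \<open>\<open>b\<close> is a lattice point, being the image of 0. The map between the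
    \<open>k\<close>-th dilates has translation part \<open>k\<close> times \<open>b\<close>, so it
    differs from the isomorphism by an integral multiple of a lattice point.\<close>
  have "A *v 0 + b \<in> (\<lambda>x. A *v x + b) ` lattice" by (rule imageI[OF zero_lattice])
  then have bL: "b \<in> lattice" unfolding L by simp
  have inj: "x = y" if "A *v x = A *v y" for x y using injD[OF bij_is_inj[OF bij], of x y] that by simp
  have scale: "A *v (real k *\<^sub>R p) + real k *\<^sub>R b = real k *\<^sub>R (A *v p + b)" for p
    by (simp add: matrix_vector_mult_scaleR scaleR_add_right)
  have "bij_betw (\<lambda>x. A *v x + real k *\<^sub>R b) (lattice \<inter> (\<lambda>y. real k *\<^sub>R y) ` P) (lattice \<inter> (\<lambda>y. real k *\<^sub>R y) ` Q)"
  proof (rule bij_betw_imageI)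
    show "inj_on (\<lambda>x. A *v x + real k *\<^sub>R b) (lattice \<inter> (\<lambda>y. real k *\<^sub>R y) ` P)"
      using inj by (auto simp: inj_on_def)
    show "(\<lambda>x. A *v x + real k *\<^sub>R b) ` (lattice \<inter> (\<lambda>y. real k *\<^sub>R y) ` P) = lattice \<inter> (\<lambda>y. real k *\<^sub>R y) ` Q"
    proof (intro equalityI subsetI)
      fix y assume "y \<in> (\<lambda>x. A *v x + real k *\<^sub>R b) ` (lattice \<inter> (\<lambda>y. real k *\<^sub>R y) ` P)"
      then obtain x p where x: "x \<in> lattice" "p \<in> P" "x = real k *\<^sub>R p" "y = A *v x + real k *\<^sub>R b" by blast
      have "A *v x + b \<in> lattice" using x L by blast
      then have "(A *v x + b) + (real k - 1) *\<^sub>R b \<in> lattice"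
        by (rule lattice_add[OF _ lattice_scale[OF _ bL]]) simp
      moreover have "(A *v x + b) + (real k - 1) *\<^sub>R b = y" unfolding x(4) by (simp add: algebra_simps)
      moreover have "y = real k *\<^sub>R (A *v p + b)" unfolding x(3,4) by (rule scale)
      ultimately show "y \<in> lattice \<inter> (\<lambda>y. real k *\<^sub>R y) ` Q" using x Q by auto
    next
      fix y assume "y \<in> lattice \<inter> (\<lambda>y. real k *\<^sub>R y) ` Q"
      then obtain p where p: "y \<in> lattice" "p \<in> P" "y = real k *\<^sub>R (A *v p + b)" using Q by blast
      have "y - (real k - 1) *\<^sub>R b \<in> lattice" by (rule lattice_diff[OF p(1) lattice_scale[OF _ bL]]) simp
      then obtain x where x: "x \<in> lattice" "y - (real k - 1) *\<^sub>R b = A *v x + b" using L by blast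
      then have yx: "y = A *v x + real k *\<^sub>R b" by (simp add: algebra_simps)
      then have "A *v x = A *v (real k *\<^sub>R p)" using p(3) scale[of p] by simp
      then have "x = real k *\<^sub>R p" by (rule inj)
      then show "y \<in> (\<lambda>x. A *v x + real k *\<^sub>R b) ` (lattice \<inter> (\<lambda>y. real k *\<^sub>R y) ` P)" using x p yx by blast
    qed
  qed
  then show ?thesis by (rule bij_betw_same_card)
qed

text \<open>Volume is recovered as the limit of the lattice point counts of the dilates, which the
  isomorphism preserves; this replaces a computation of the determinant.\<close>

lemma lattice_isomorphic_measure:
  fixes P Q :: "(real ^ 'n) set"
  assumes "lattice_isomorphic P Q" "convex P" "compact P" "convex Q" "compact Q"
  shows "measure lborel P = measure lborel Q" "card (lattice \<inter> P) = card (lattice \<inter> Q)"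
proof -
  obtain A b where "bij (\<lambda>x. A *v x + b)" "(\<lambda>x. A *v x + b) ` lattice = lattice" "(\<lambda>x. A *v x + b) ` P = Q"
    using assms(1) unfolding lattice_isomorphic_def by blast
  note card_eq = lattice_isomorphic_card_scaled[OF this]
  show "measure lborel P = measure lborel Q"
    using lattice_count_limit[OF assms(2,3)] lattice_count_limit[OF assms(4,5)]
    unfolding card_lattice_Int card_eq by (rule LIMSEQ_unique)
  show "card (lattice \<inter> P) = card (lattice \<inter> Q)" using card_eq[of 1] by simp
qed

theorem theorem3:
  fixes P :: "(real ^ 'n) set"
  assumes "lattice_polytope P"
    and "aff_dim P = int CARD('n)"
    and "adjoint_sections P \<noteq> {0}"
  shows "delta_genus P \<ge> real CARD('n) - 1 \<and>
    (CARD('n) \<ge> 3 \<longrightarrow>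
      (delta_genus P = real CARD('n) - 1 \<longleftrightarrow>
        lattice_isomorphic P (mirror_polytope :: (real ^ 'n) set)))"
proof -
  have ne: "P \<noteq> {}" using assms(2) by auto
  obtain V0 where V0: "finite V0" "V0 \<subseteq> lattice" "P = convex hull V0"
    using assms(1) unfolding lattice_polytope_def by blast
  obtain p where p: "p \<in> interior P" "p \<in> lattice"
    using adjoint_sections_nonzero_iff[OF assms(1) ne] assms(3) by blast
  define V where "V = (+) (- p) ` V0"
  have hull: "convex hull V = (+) (- p) ` P" unfolding V_def V0(3) by (rule convex_hull_translation)
  have V: "finite V" "V \<subseteq> lattice"
    using V0 lattice_diff[OF _ p(2)] by (auto simp: V_def simp del: image_iff)
  have "0 \<in> interior (convex hull V)"
    unfolding hull interior_translation using p(1) by force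
  from boundary_fan_ex[OF V this] obtain T where "boundary_fan T V" .
  then interpret boundary_fan T V .
  have "measure lebesgue (convex hull V) = measure lebesgue P" unfolding hull by (rule measure_translation)
  then have vol: "normalized_volume V = fact CARD('n) * measure lborel P"
    using measure_lebesgue_convex_hull[OF V(1)] measure_lebesgue_convex_hull[OF V0(1)]
    by (simp add: normalized_volume_def V0(3))
  have "lattice \<inter> convex hull V = (+) (- p) ` (lattice \<inter> P)"
  proof (intro equalityI subsetI)
    fix x assume "x \<in> lattice \<inter> convex hull V"
    then have "x + p \<in> lattice" "x + p \<in> P" using lattice_add[OF _ p(2)] by (auto simp: hull simp del: image_iff)
    then show "x \<in> (+) (- p) ` (lattice \<inter> P)" by (intro image_eqI[of _ _ "x + p"]) auto
  next
    fix x assume "x \<in> (+) (- p) ` (lattice \<inter> P)"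
    then obtain y where "x = y - p" "y \<in> lattice" "y \<in> P" by auto
    then show "x \<in> lattice \<inter> convex hull V" using lattice_diff[OF _ p(2)] by (auto simp: hull simp del: image_iff)
  qed
  then have card: "card (lattice \<inter> convex hull V) = card (lattice \<inter> P)" by (simp add: card_image)
  have delta: "delta_genus P = real CARD('n) + normalized_volume V - real (card (lattice \<inter> convex hull V))"
    using delta_genus_eq[OF assms(1) ne] by (simp add: vol card card_lattice_Int)
  have ge: "delta_genus P \<ge> real CARD('n) - 1" using card_lattice_points_le_volume by (simp add: delta)
  moreover have "delta_genus P = real CARD('n) - 1 \<longleftrightarrow> lattice_isomorphic P (mirror_polytope :: (real ^ 'n) set)"
    if dim: "3 \<le> CARD('n)"
  proof
    assume "delta_genus P = real CARD('n) - 1"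
    then have "real (card (lattice \<inter> convex hull V)) = 1 + normalized_volume V" by (simp add: delta)
    from tight_simplex[OF this dim] obtain \<sigma> where \<sigma>: "\<sigma> \<in> T" "normalized_volume (insert 0 \<sigma>) = 1"
      "convex hull V = convex hull (insert (- \<Sum>\<sigma>) \<sigma>)" .
    have \<sigma>L: "\<sigma> \<subseteq> lattice" using cell_subset[OF \<sigma>(1)] V by blast
    obtain B :: "real ^ 'n ^ 'n" where B: "invertible B" "(*v) B ` lattice = lattice"
      "(*v) B ` mirror_polytope = convex hull (insert (- \<Sum>\<sigma>) \<sigma>)"
      using matrix_of_basis[OF independent_cell[OF \<sigma>(1)] _ \<sigma>L \<sigma>(2)] card_cell[OF \<sigma>(1)] by auto
    \<comment> \<open>The isomorphism will be \<open>x \<mapsto> A *v (x - p)\<close>, with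
      \<open>A\<close> inverse to the matrix of the unimodular cell.\<close>
    obtain A where "B ** A = mat 1" "A ** B = mat 1" using B(1) unfolding invertible_def by blast
    then have AB: "A *v (B *v x) = x" "B *v (A *v x) = x" for x
      by (simp_all add: matrix_vector_mul_assoc)
    have A_image: "(*v) A ` (*v) B ` S = S" for S by (simp add: image_image AB)
    have shift: "(\<lambda>x. A *v x + - (A *v p)) ` S = (*v) A ` (+) (- p) ` S" for S
      by (simp add: image_image matrix_vector_mult_diff_distrib)
    have "(+) (- p) ` lattice = lattice"
    proof (intro equalityI subsetI)
      fix x :: "real ^ 'n" assume "x \<in> lattice"
      then show "x \<in> (+) (- p) ` lattice"
        using lattice_add[OF _ p(2)] by (intro image_eqI[of _ _ "x + p"]) auto
    qed (use lattice_diff[OF _ p(2)] in \<open>auto simp del: image_iff\<close>)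
    then have "(\<lambda>x. A *v x + - (A *v p)) ` lattice = lattice"
      unfolding shift using A_image[of lattice] B(2) by simp
    moreover have "(\<lambda>x. A *v x + - (A *v p)) ` P = mirror_polytope"
      unfolding shift hull[symmetric] \<sigma>(3) B(3)[symmetric] A_image ..
    moreover have "bij (\<lambda>x. A *v x + - (A *v p))"
      by (rule bij_betw_byWitness[where f' = "\<lambda>y. B *v y + p"])
        (auto simp: AB matrix_vector_right_distrib matrix_vector_mult_diff_distrib)
    ultimately show "lattice_isomorphic P mirror_polytope" unfolding lattice_isomorphic_def by blast
  next
    assume iso: "lattice_isomorphic P (mirror_polytope :: (real ^ 'n) set)"
    have "convex (mirror_polytope :: (real ^ 'n) set)" "compact (mirror_polytope :: (real ^ 'n) set)"
      by (auto simp: mirror_polytope_def finite_imp_compact_convex_hull)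
    note eqs = lattice_isomorphic_measure[OF iso lattice_polytope_convex[OF assms(1)] lattice_polytope_compact[OF assms(1)] this]
    have "normalized_volume V = real CARD('n) + 1"
      using normalized_volume_mirror[where 'n = 'n] unfolding vol eqs(1) by (simp add: normalized_volume_def mirror_polytope_def)
    moreover have "CARD('n) + 2 \<le> card (lattice \<inter> convex hull V)"
      using card_lattice_mirror[where 'n = 'n] unfolding card eqs(2) .
    ultimately show "delta_genus P = real CARD('n) - 1" using ge by (simp add: delta)
  qed
  ultimately show ?thesis by blast
qed

end
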